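(* Let $P$ be a permutation simply typed, input-linear program with input selectability and let $Q$ be a permutation simply typed query. Let $p$ be a predicate whose input positions are all bound and of constant type. Then in any delay-respecting derivation of $P\cup\{Q\}$, an atom using $p$ is selected only when its input arguments are correctly typed (i.e. each input argument belongs to the type associated with its position).
   Context: Basics. A query is a finite sequence of atoms; a clause is $h\leftarrow B$ with $h$ an atom and $B$ a query. Built-in predicates are regarded as defined by possibly infinitely many fact clauses belonging to the program. Every predicate has a fixed mode, i.e. each argument position is either input or output; $p(\mathbf s,\mathbf t)$ denotes an atom with $\mathbf s$ (resp. $\mathbf t$) the vector of terms filling the input (resp. output) positions. In clause heads $p(\mathbf t_0,\mathbf s_{n+1})$, $\mathbf t_0$ is the input and $\mathbf s_{n+1}$ the output. A syntactic object is linear if each variable occurs in it at most once. A clause is input-linear if the vector of input terms of its head is linear; a program is input-linear if all its clauses are and it does not use the equality predicate $=$ with both arguments input. A flat term is a variable or a term $f(x_1,\dots,x_n)$, $n\ge 0$, with distinct variables $x_i$. A permutation $\pi$ on $\{1,\dots,n\}$ is extended by $\pi(i)=i$ outside $\{1,\dots,n\}$. Types. A type is a non-empty set of terms closed under instantiation. The variable type is the type of all terms; any other type is a non-variable type. A constant type is a type consisting only of (possibly infinitely many) constants. Each argument position of each predicate has an associated type. $t:T$ means $t\in T$ (componentwise for vectors); $\models \varphi\Rightarrow \mathbf t:\mathbf T$ means that the implication holds after applying any substitution to all terms. A term is type-consistent (in a position of type $T$) if some instance of it is in $T$. Nicely moded. $Q=p_1(\mathbf s_1,\mathbf t_1),\dots,p_n(\mathbf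 s_n,\mathbf t_n)$ is $\pi$-nicely moded if $\mathbf t_1,\dots,\mathbf t_n$ is linear and for all $i$, $vars(\mathbf s_i)\cap\bigcup_{\pi(i)\le\pi(j)\le n}vars(\mathbf t_j)=\emptyset$. A clause $p(\mathbf t_0,\mathbf s_{n+1})\leftarrow Q$ is $\pi$-nicely moded if $Q$ is and $vars(\mathbf t_0)\cap\bigcup_{j=1}^n vars(\mathbf t_j)=\emptyset$. Well typed. With $p_i(\mathbf S_i,\mathbf T_i)$ the type of $p_i$, $Q$ is $\pi$-well typed if for all $i\in\{1,\dots,n\}$, $\models(\bigwedge_{1\le\pi(j)<\pi(i)}\mathbf t_j:\mathbf T_j)\Rightarrow\mathbf s_i:\mathbf S_i$. A clause $p(\mathbf t_0,\mathbf s_{n+1})\leftarrow Q$, with $p(\mathbf T_0,\mathbf S_{n+1})$ the type of $p$, is $\pi$-well typed if for all $i\in\{1,\dots,n+1\}$, $\models(\bigwedge_{0\le\pi(j)<\pi(i)}\mathbf t_j:\mathbf T_j)\Rightarrow\mathbf s_i:\mathbf S_i$. Simply typed. $Q$ is $\pi$-simply typed if it is $\pi$-nicely moded and $\pi$-well typed and $\mathbf t_1,\dots,\mathbf t_n$ is a vector of variables. A clause $p(\mathbf t_0,\mathbf s_{n+1})\leftarrow Q$ is $\pi$-simply typed if it is $\pi$-nicely moded and $\pi$-well typed, $\mathbf t_1,\dots,\mathbf t_n$ is a vector of variables, and $\mathbf t_0$ is a vector of flat type-consistent terms that has a variable in each position of variable type. "Permutation simply typed" means $\pi$-simply typed for some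 $\pi$ (for each clause, for programs). Bound/free. An input position of a predicate $p$ is bound (in $P$) if some clause head $p(\dots)$ in $P$ has a non-variable term there; an output position is bound if some body atom $p(\dots)$ in $P$ has a non-variable term there; otherwise it is free. Derivations. A program consists of clauses and, for each predicate $p/n$, a block declaration: a (possibly empty) set of atoms $p(b_1,\dots,b_n)$ with $b_i\in\{?,-\}$. An atom $p(t_1,\dots,t_n)$ is blocked if for some $p(b_1,\dots,b_n)$ in the declaration, $t_i$ is a variable for all $i$ with $b_i=-$; otherwise it is selectable. In a derivation step a query $Q_1,a,Q_2$ is replaced by $(Q_1,B,Q_2)\theta$, where $h\leftarrow B$ is a variant, renamed apart, of a program clause and $\theta$ is a most general unifier of the selected atom $a$ and $h$. A derivation of $P\cup\{Q\}$ is a sequence of such steps starting at $Q$; it is delay-respecting if the selected atom is always selectable. Input selectability. $P$ has input selectability if every atom (using a predicate of $P$) that has variables in all free output positions is selectable in $P$ (1) only if it is non-variable in all bound input positions, and (2) if it is non-variable in all input positions of non-variable type. *)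

theory Defs
  imports "HOL-Combinatorics.Permutations" "HOL-Library.Extended_Nat"
begin

section \<open>Terms and substitutions\<close>

text \<open>A function symbol used with different numbers of arguments counts as several symbols;
  constants are the terms \<open>Fun c []\<close>.\<close>

datatype ('f, 'v) trm = Var 'v | Fun 'f "('f, 'v) trm list"

type_synonym ('f, 'v) subst = "'v \<Rightarrow> ('f, 'v) trm"

fun subst_trm :: "('f, 'v) subst \<Rightarrow> ('f, 'v) trm \<Rightarrow> ('f, 'v) trm" where
  "subst_trm \<sigma> (Var x) = \<sigma> x"
| "subst_trm \<sigma> (Fun f ts) = Fun f (map (subst_trm \<sigma>) ts)"

definition subst_comp :: "('f, 'v) subst \<Rightarrow> ('f, 'v) subst \<Rightarrow> ('f, 'v) subst" where
  "subst_comp \<theta> \<delta> = (\<lambda>x. subst_trm \<delta> (\<theta> x))"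

fun is_variable :: "('f, 'v) trm \<Rightarrow> bool" where
  "is_variable (Var x) = True"
| "is_variable (Fun f ts) = False"

fun var_occs :: "('f, 'v) trm \<Rightarrow> 'v list" where
  "var_occs (Var x) = [x]"
| "var_occs (Fun f ts) = concat (map var_occs ts)"

definition vars :: "('f, 'v) trm list \<Rightarrow> 'v set" where
  "vars ts = (\<Union>t\<in>set ts. set (var_occs t))"

definition linear :: "('f, 'v) trm list \<Rightarrow> bool" where
  "linear ts \<longleftrightarrow> distinct (concat (map var_occs ts))"

definition flat :: "('f, 'v) trm \<Rightarrow> bool" where
  "flat t \<longleftrightarrow> is_variable t \<or> (\<exists>f xs. distinct xs \<and> t = Fun f (map Var xs))"


section \<open>Types\<close>

definition is_type :: "('f, 'v) trm set \<Rightarrow> bool" where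
  "is_type T \<longleftrightarrow> T \<noteq> {} \<and> (\<forall>t\<in>T. \<forall>\<sigma>. subst_trm \<sigma> t \<in> T)"

abbreviation variable_type :: "('f, 'v) trm set" where
  "variable_type \<equiv> UNIV"

definition constant_type :: "('f, 'v) trm set \<Rightarrow> bool" where
  "constant_type T \<longleftrightarrow> is_type T \<and> (\<forall>t\<in>T. \<exists>c. t = Fun c [])"

definition type_consistent :: "('f, 'v) trm set \<Rightarrow> ('f, 'v) trm \<Rightarrow> bool" where
  "type_consistent T t \<longleftrightarrow> (\<exists>\<sigma>. subst_trm \<sigma> t \<in> T)"

definition has_types :: "('f, 'v) trm list \<Rightarrow> ('f, 'v) trm set list \<Rightarrow> bool" where
  "has_types ts Ts \<longleftrightarrow> list_all2 (\<in>) ts Ts"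


section \<open>Programs\<close>

text \<open>\<open>Eq\<close> is the built-in equality predicate \<open>=\<close>. It is singled out only because input-linearity
  refers to it.\<close>

datatype 'p pred_sym = Eq | Pred 'p

datatype ('p, 'f, 'v) atom = Atom (psym: "'p pred_sym") (args: "('f, 'v) trm list")

type_synonym ('p, 'f, 'v) query = "('p, 'f, 'v) atom list"

datatype ('p, 'f, 'v) clause = Clause (head: "('p, 'f, 'v) atom") (body: "('p, 'f, 'v) query")

datatype io = Input | Output

text \<open>\<open>Any\<close> and \<open>NonVar\<close> are the marks \<open>?\<close> and \<open>-\<close> of block declarations.\<close>

datatype mark = Any | NonVar

text \<open>The set of clauses may be infinite and contains the facts that define the built-in
  predicates. The arity of a predicate \<open>p\<close> is the length of \<open>mode P p\<close>. Argument positions are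
  counted from 0.\<close>

record ('p, 'f, 'v) program =
  clauses :: "('p, 'f, 'v) clause set"
  mode    :: "'p pred_sym \<Rightarrow> io list"
  types   :: "'p pred_sym \<Rightarrow> ('f, 'v) trm set list"
  blocks  :: "'p pred_sym \<Rightarrow> mark list set"

definition arity :: "('p, 'f, 'v) program \<Rightarrow> 'p pred_sym \<Rightarrow> nat" where
  "arity P p = length (mode P p)"

definition wf_atom :: "('p, 'f, 'v) program \<Rightarrow> ('p, 'f, 'v) atom \<Rightarrow> bool" where
  "wf_atom P a \<longleftrightarrow> length (args a) = arity P (psym a)"

definition wf_query :: "('p, 'f, 'v) program \<Rightarrow> ('p, 'f, 'v) query \<Rightarrow> bool" where
  "wf_query P Q \<longleftrightarrow> (\<forall>a\<in>set Q. wf_atom P a)"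

definition wf_program :: "('p, 'f, 'v) program \<Rightarrow> bool" where
  "wf_program P \<longleftrightarrow>
     (\<forall>C\<in>clauses P. wf_atom P (head C) \<and> wf_query P (body C)) \<and>
     (\<forall>p. length (types P p) = arity P p \<and> (\<forall>T\<in>set (types P p). is_type T)) \<and>
     (\<forall>p. \<forall>b\<in>blocks P p. length b = arity P p)"

definition preds :: "('p, 'f, 'v) program \<Rightarrow> 'p pred_sym set" where
  "preds P = (\<Union>C\<in>clauses P. psym ` set (head C # body C))"

definition has_mode :: "io \<Rightarrow> ('p, 'f, 'v) program \<Rightarrow> 'p pred_sym \<Rightarrow> nat \<Rightarrow> bool" where
  "has_mode m P p i \<longleftrightarrow> i < arity P p \<and> mode P p ! i = m"

definition select :: "io \<Rightarrow> io list \<Rightarrow> 'a list \<Rightarrow> 'a list" where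
  "select m ms xs = map snd (filter (\<lambda>(m', x). m' = m) (zip ms xs))"

definition ins :: "('p, 'f, 'v) program \<Rightarrow> ('p, 'f, 'v) atom \<Rightarrow> ('f, 'v) trm list" where
  "ins P a = select Input (mode P (psym a)) (args a)"

definition outs :: "('p, 'f, 'v) program \<Rightarrow> ('p, 'f, 'v) atom \<Rightarrow> ('f, 'v) trm list" where
  "outs P a = select Output (mode P (psym a)) (args a)"

definition in_types :: "('p, 'f, 'v) program \<Rightarrow> ('p, 'f, 'v) atom \<Rightarrow> ('f, 'v) trm set list" where
  "in_types P a = select Input (mode P (psym a)) (types P (psym a))"

definition out_types :: "('p, 'f, 'v) program \<Rightarrow> ('p, 'f, 'v) atom \<Rightarrow> ('f, 'v) trm set list" where
  "out_types P a = select Output (mode P (psym a)) (types P (psym a))"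

definition input_linear :: "('p, 'f, 'v) program \<Rightarrow> bool" where
  "input_linear P \<longleftrightarrow>
     (\<forall>C\<in>clauses P. linear (ins P (head C))) \<and>
     \<not> (mode P Eq = [Input, Input] \<and> (\<exists>C\<in>clauses P. \<exists>a\<in>set (body C). psym a = Eq))"


section \<open>Permutation nicely moded, well typed and simply typed\<close>

text \<open>Atoms of a query are numbered from 1, as permutations act on \<open>{1..n}\<close>: atom \<open>i\<close> of \<open>Q\<close> is
  \<open>Q ! (i - 1)\<close>. Below, \<open>\<pi>\<close> is always meant to satisfy \<open>\<pi> permutes {1..length Q}\<close>, which
  includes \<open>\<pi> i = i\<close> for \<open>i\<close> outside \<open>{1..length Q}\<close>.\<close>

abbreviation nth_atom :: "('p, 'f, 'v) query \<Rightarrow> nat \<Rightarrow> ('p, 'f, 'v) atom" where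
  "nth_atom Q i \<equiv> Q ! (i - 1)"

definition nicely_moded_query ::
    "('p, 'f, 'v) program \<Rightarrow> (nat \<Rightarrow> nat) \<Rightarrow> ('p, 'f, 'v) query \<Rightarrow> bool" where
  "nicely_moded_query P \<pi> Q \<longleftrightarrow>
     linear (concat (map (outs P) Q)) \<and>
     (\<forall>i\<in>{1..length Q}.
        vars (ins P (nth_atom Q i)) \<inter>
        (\<Union>j\<in>{j\<in>{1..length Q}. \<pi> i \<le> \<pi> j \<and> \<pi> j \<le> length Q}. vars (outs P (nth_atom Q j))) = {})"

definition nicely_moded_clause ::
    "('p, 'f, 'v) program \<Rightarrow> (nat \<Rightarrow> nat) \<Rightarrow> ('p, 'f, 'v) clause \<Rightarrow> bool" where
  "nicely_moded_clause P \<pi> C \<longleftrightarrow>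
     nicely_moded_query P \<pi> (body C) \<and>
     vars (ins P (head C)) \<inter> (\<Union>j\<in>{1..length (body C)}. vars (outs P (nth_atom (body C) j))) = {}"

definition well_typed_query ::
    "('p, 'f, 'v) program \<Rightarrow> (nat \<Rightarrow> nat) \<Rightarrow> ('p, 'f, 'v) query \<Rightarrow> bool" where
  "well_typed_query P \<pi> Q \<longleftrightarrow>
     (\<forall>i\<in>{1..length Q}. \<forall>\<sigma>.
        (\<forall>j\<in>{1..length Q}. 1 \<le> \<pi> j \<and> \<pi> j < \<pi> i \<longrightarrow>
           has_types (map (subst_trm \<sigma>) (outs P (nth_atom Q j))) (out_types P (nth_atom Q j)))
        \<longrightarrow> has_types (map (subst_trm \<sigma>) (ins P (nth_atom Q i))) (in_types P (nth_atom Q i)))"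

text \<open>In a clause \<open>p(t\<^sub>0, s\<^sub>n\<^sub>+\<^sub>1) \<leftarrow> p\<^sub>1(s\<^sub>1, t\<^sub>1), \<dots>, p\<^sub>n(s\<^sub>n, t\<^sub>n)\<close> the producing positions are
  \<open>t\<^sub>0, \<dots>, t\<^sub>n\<close> and the consuming ones \<open>s\<^sub>1, \<dots>, s\<^sub>n\<^sub>+\<^sub>1\<close>.\<close>

definition prod_terms ::
    "('p, 'f, 'v) program \<Rightarrow> ('p, 'f, 'v) clause \<Rightarrow> nat \<Rightarrow> ('f, 'v) trm list" where
  "prod_terms P C j = (if j = 0 then ins P (head C) else outs P (nth_atom (body C) j))"

definition prod_types ::
    "('p, 'f, 'v) program \<Rightarrow> ('p, 'f, 'v) clause \<Rightarrow> nat \<Rightarrow> ('f, 'v) trm set list" where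
  "prod_types P C j = (if j = 0 then in_types P (head C) else out_types P (nth_atom (body C) j))"

definition cons_terms ::
    "('p, 'f, 'v) program \<Rightarrow> ('p, 'f, 'v) clause \<Rightarrow> nat \<Rightarrow> ('f, 'v) trm list" where
  "cons_terms P C i =
     (if i = length (body C) + 1 then outs P (head C) else ins P (nth_atom (body C) i))"

definition cons_types ::
    "('p, 'f, 'v) program \<Rightarrow> ('p, 'f, 'v) clause \<Rightarrow> nat \<Rightarrow> ('f, 'v) trm set list" where
  "cons_types P C i =
     (if i = length (body C) + 1 then out_types P (head C) else in_types P (nth_atom (body C) i))"

definition well_typed_clause ::
    "('p, 'f, 'v) program \<Rightarrow> (nat \<Rightarrow> nat) \<Rightarrow> ('p, 'f, 'v) clause \<Rightarrow> bool" where
  "well_typed_clause P \<pi> C \<longleftrightarrow>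
     (\<forall>i\<in>{1..length (body C) + 1}. \<forall>\<sigma>.
        (\<forall>j\<in>{0..length (body C)}. 0 \<le> \<pi> j \<and> \<pi> j < \<pi> i \<longrightarrow>
           has_types (map (subst_trm \<sigma>) (prod_terms P C j)) (prod_types P C j))
        \<longrightarrow> has_types (map (subst_trm \<sigma>) (cons_terms P C i)) (cons_types P C i))"

definition simply_typed_query ::
    "('p, 'f, 'v) program \<Rightarrow> (nat \<Rightarrow> nat) \<Rightarrow> ('p, 'f, 'v) query \<Rightarrow> bool" where
  "simply_typed_query P \<pi> Q \<longleftrightarrow>
     nicely_moded_query P \<pi> Q \<and> well_typed_query P \<pi> Q \<and>
     (\<forall>a\<in>set Q. \<forall>t\<in>set (outs P a). is_variable t)"

definition simply_typed_clause ::
    "('p, 'f, 'v) program \<Rightarrow> (nat \<Rightarrow> nat) \<Rightarrow> ('p, 'f, 'v) clause \<Rightarrow> bool" where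
  "simply_typed_clause P \<pi> C \<longleftrightarrow>
     nicely_moded_clause P \<pi> C \<and> well_typed_clause P \<pi> C \<and>
     (\<forall>a\<in>set (body C). \<forall>t\<in>set (outs P a). is_variable t) \<and>
     list_all2 (\<lambda>t T. flat t \<and> type_consistent T t \<and> (T = variable_type \<longrightarrow> is_variable t))
       (ins P (head C)) (in_types P (head C))"

definition permutation_simply_typed_query ::
    "('p, 'f, 'v) program \<Rightarrow> ('p, 'f, 'v) query \<Rightarrow> bool" where
  "permutation_simply_typed_query P Q \<longleftrightarrow>
     (\<exists>\<pi>. \<pi> permutes {1..length Q} \<and> simply_typed_query P \<pi> Q)"

definition permutation_simply_typed_program :: "('p, 'f, 'v) program \<Rightarrow> bool" where
  "permutation_simply_typed_program P \<longleftrightarrow>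
     (\<forall>C\<in>clauses P. \<exists>\<pi>. \<pi> permutes {1..length (body C)} \<and> simply_typed_clause P \<pi> C)"


section \<open>Block declarations and input selectability\<close>

definition bound_position :: "('p, 'f, 'v) program \<Rightarrow> 'p pred_sym \<Rightarrow> nat \<Rightarrow> bool" where
  "bound_position P p i \<longleftrightarrow>
     has_mode Input P p i \<and>
       (\<exists>C\<in>clauses P. psym (head C) = p \<and> \<not> is_variable (args (head C) ! i)) \<or>
     has_mode Output P p i \<and>
       (\<exists>C\<in>clauses P. \<exists>a\<in>set (body C). psym a = p \<and> \<not> is_variable (args a ! i))"

definition blocked :: "('p, 'f, 'v) program \<Rightarrow> ('p, 'f, 'v) atom \<Rightarrow> bool" where
  "blocked P a \<longleftrightarrow>
     (\<exists>b\<in>blocks P (psym a).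
        \<forall>i<arity P (psym a). b ! i = NonVar \<longrightarrow> is_variable (args a ! i))"

definition selectable :: "('p, 'f, 'v) program \<Rightarrow> ('p, 'f, 'v) atom \<Rightarrow> bool" where
  "selectable P a \<longleftrightarrow> \<not> blocked P a"

definition input_selectability :: "('p, 'f, 'v) program \<Rightarrow> bool" where
  "input_selectability P \<longleftrightarrow>
     (\<forall>a. wf_atom P a \<and> psym a \<in> preds P \<and>
        (\<forall>i. has_mode Output P (psym a) i \<and> \<not> bound_position P (psym a) i
             \<longrightarrow> is_variable (args a ! i)) \<longrightarrow>
        (selectable P a \<longrightarrow>
           (\<forall>i. has_mode Input P (psym a) i \<and> bound_position P (psym a) i
                \<longrightarrow> \<not> is_variable (args a ! i))) \<and>
        ((\<forall>i. has_mode Input P (psym a) i \<and> types P (psym a) ! i \<noteq> variable_type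
              \<longrightarrow> \<not> is_variable (args a ! i)) \<longrightarrow> selectable P a))"


section \<open>Derivations\<close>

definition subst_atom :: "('f, 'v) subst \<Rightarrow> ('p, 'f, 'v) atom \<Rightarrow> ('p, 'f, 'v) atom" where
  "subst_atom \<sigma> a = Atom (psym a) (map (subst_trm \<sigma>) (args a))"

definition subst_query :: "('f, 'v) subst \<Rightarrow> ('p, 'f, 'v) query \<Rightarrow> ('p, 'f, 'v) query" where
  "subst_query \<sigma> Q = map (subst_atom \<sigma>) Q"

definition subst_clause :: "('f, 'v) subst \<Rightarrow> ('p, 'f, 'v) clause \<Rightarrow> ('p, 'f, 'v) clause" where
  "subst_clause \<sigma> C = Clause (subst_atom \<sigma> (head C)) (subst_query \<sigma> (body C))"

definition vars_query :: "('p, 'f, 'v) query \<Rightarrow> 'v set" where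
  "vars_query Q = (\<Union>a\<in>set Q. vars (args a))"

definition vars_clause :: "('p, 'f, 'v) clause \<Rightarrow> 'v set" where
  "vars_clause C = vars_query (head C # body C)"

definition variant :: "('p, 'f, 'v) clause \<Rightarrow> ('p, 'f, 'v) clause \<Rightarrow> bool" where
  "variant C' C \<longleftrightarrow> (\<exists>\<rho>. bij \<rho> \<and> C' = subst_clause (\<lambda>x. Var (\<rho> x)) C)"

definition is_mgu ::
    "('f, 'v) subst \<Rightarrow> ('p, 'f, 'v) atom \<Rightarrow> ('p, 'f, 'v) atom \<Rightarrow> bool" where
  "is_mgu \<theta> a b \<longleftrightarrow>
     subst_atom \<theta> a = subst_atom \<theta> b \<and>
     (\<forall>\<sigma>. subst_atom \<sigma> a = subst_atom \<sigma> b \<longrightarrow> (\<exists>\<delta>. \<sigma> = subst_comp \<theta> \<delta>))"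

text \<open>Here \<open>k\<close> is the position (from 0) of the selected atom, and renaming apart is with respect
  to the current query.\<close>

definition derivation_step ::
    "('p, 'f, 'v) program \<Rightarrow> ('p, 'f, 'v) query \<Rightarrow> nat \<Rightarrow> ('p, 'f, 'v) query \<Rightarrow> bool" where
  "derivation_step P Q k Q' \<longleftrightarrow>
     k < length Q \<and>
     (\<exists>C\<in>clauses P. \<exists>C' \<theta>.
        variant C' C \<and> vars_clause C' \<inter> vars_query Q = {} \<and>
        is_mgu \<theta> (Q ! k) (head C') \<and>
        Q' = subst_query \<theta> (take k Q @ body C' @ drop (Suc k) Q))"

text \<open>A derivation with \<open>N\<close> steps (possibly infinitely many), queries \<open>qs 0, qs 1, \<dots>\<close>, and
  selected atom \<open>qs i ! k\<close> in query \<open>qs i\<close> if \<open>sel i = Some k\<close>. In the last query of a finite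
  derivation there may also be a selected atom that is not resolved, as in a failed
  derivation: a call that unifies with no clause head has still been selected.\<close>

definition derivation ::
    "('p, 'f, 'v) program \<Rightarrow> ('p, 'f, 'v) query \<Rightarrow>
     enat \<Rightarrow> (nat \<Rightarrow> ('p, 'f, 'v) query) \<Rightarrow> (nat \<Rightarrow> nat option) \<Rightarrow> bool" where
  "derivation P Q N qs sel \<longleftrightarrow>
     qs 0 = Q \<and>
     (\<forall>i. enat i < N \<longrightarrow> (\<exists>k. sel i = Some k \<and> derivation_step P (qs i) k (qs (Suc i)))) \<and>
     (\<forall>i k. enat i \<le> N \<and> sel i = Some k \<longrightarrow> k < length (qs i))"

definition delay_respecting ::
    "('p, 'f, 'v) program \<Rightarrow>
     enat \<Rightarrow> (nat \<Rightarrow> ('p, 'f, 'v) query) \<Rightarrow> (nat \<Rightarrow> nat option) \<Rightarrow> bool" where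
  "delay_respecting P N qs sel \<longleftrightarrow>
     (\<forall>i k. enat i \<le> N \<and> sel i = Some k \<longrightarrow> selectable P (qs i ! k))"

end

theory Submission
  imports Defs
begin

text \<open>The invariant of a derivation is that the atoms of the query can be listed so that every atom
  comes after the producers of its input, as in the definition of permutation simply typed queries,
  but with the order given by a list rather than by \<open>\<pi>\<close>. For a selected atom \<open>p(s, t)\<close>, input
  selectability makes \<open>s\<close> non-variable wherever some clause head is, so a linear flat head input \<open>v\<close>
  that unifies with \<open>s\<close> even matches it; as \<open>t\<close> consists of distinct variables not in \<open>s\<close>, a unifier
  is obtained by matching \<open>v\<close> against \<open>s\<close> and then sending \<open>t\<close> to the instantiated head output. Hence
  the mgu only renames the output variables of all other atoms, and the resolvent is again simply
  typed when the body is put in the place of the selected atom. In such a query every input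
  argument has a correctly typed instance, and a non-variable term with an instance in a constant
  type is that constant.\<close>

section \<open>Substitutions, linearity and matching\<close>

lemma subst_trm_cong:
  "(\<And>x. x \<in> set (var_occs t) \<Longrightarrow> \<sigma> x = \<tau> x) \<Longrightarrow> subst_trm \<sigma> t = subst_trm \<tau> t"
proof (induction t)
  case (Fun f ts)
  have "subst_trm \<sigma> u = subst_trm \<tau> u" if "u \<in> set ts" for u
    using that Fun.prems by (intro Fun.IH) auto
  then show ?case
    by simp
qed simp

lemma map_subst_trm_cong:
  "(\<And>x. x \<in> vars ts \<Longrightarrow> \<sigma> x = \<tau> x) \<Longrightarrow> map (subst_trm \<sigma>) ts = map (subst_trm \<tau>) ts"
  unfolding vars_def by (intro map_cong refl subst_trm_cong) blast

lemma subst_trm_Var [simp]: "subst_trm Var t = t"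
  by (induction t) (auto intro: map_idI)

lemma subst_trm_subst_trm [simp]:
  "subst_trm \<delta> (subst_trm \<theta> t) = subst_trm (subst_comp \<theta> \<delta>) t"
  by (induction t) (auto simp: subst_comp_def)

lemma set_var_occs_subst:
  "set (var_occs (subst_trm \<sigma> t)) = (\<Union>x\<in>set (var_occs t). set (var_occs (\<sigma> x)))"
  by (induction t) auto

lemma vars_append [simp]: "vars (xs @ ys) = vars xs \<union> vars ys"
  by (auto simp: vars_def)

lemma vars_Nil [simp]: "vars [] = {}"
  by (simp add: vars_def)

lemma vars_Cons [simp]: "vars (t # ts) = set (var_occs t) \<union> vars ts"
  by (simp add: vars_def)

lemma vars_concat: "vars (concat tss) = (\<Union>ts\<in>set tss. vars ts)"
  by (auto simp: vars_def)

lemma vars_map_subst: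
  "vars (map (subst_trm \<sigma>) ts) = (\<Union>x\<in>vars ts. set (var_occs (\<sigma> x)))"
  by (auto simp: vars_def set_var_occs_subst)

lemma is_variable_iff: "is_variable t \<longleftrightarrow> (\<exists>x. t = Var x)"
  by (cases t) auto

lemma vars_map_Var [simp]: "vars (map Var xs) = set xs"
  by (auto simp: vars_def)

lemma linear_map_Var [simp]: "linear (map Var xs) \<longleftrightarrow> distinct xs"
  by (simp add: linear_def comp_def)

lemma all_variables_obtain:
  assumes "\<forall>t\<in>set ts. is_variable t"
  obtains xs where "ts = map Var xs"
  using assms ex_map_conv[of ts Var] by (auto simp: is_variable_iff)

lemma linear_Cons:
  "linear (t # ts) \<longleftrightarrow> distinct (var_occs t) \<and> linear ts \<and> set (var_occs t) \<inter> vars ts = {}"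
  by (auto simp: linear_def vars_def)

lemma linear_append:
  "linear (ts @ us) \<longleftrightarrow> linear ts \<and> linear us \<and> vars ts \<inter> vars us = {}"
  by (induction ts) (auto simp: linear_Cons, auto simp: linear_def)

text \<open>In a linear list different terms share no variables, so matchers found position by
  position can be glued into a single one.\<close>

lemma linear_match:
  assumes "linear vs" and "list_all2 (\<lambda>v s. \<exists>\<sigma>. subst_trm \<sigma> v = s) vs ss"
  shows "\<exists>\<sigma>. map (subst_trm \<sigma>) vs = ss"
  using assms(2,1)
proof (induction rule: list_all2_induct)
  case Nil
  then show ?case by simp
next
  case (Cons v vs s ss)
  then obtain \<sigma> \<tau> where *: "subst_trm \<sigma> v = s" "map (subst_trm \<tau>) vs = ss"
    by (auto simp: linear_Cons)
  let ?\<rho> = "\<lambda>x. if x \<in> set (var_occs v) then \<sigma> x else \<tau> x"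
  have "subst_trm ?\<rho> v = subst_trm \<sigma> v"
    by (rule subst_trm_cong) simp
  moreover have "map (subst_trm ?\<rho>) vs = map (subst_trm \<tau>) vs"
    using Cons.prems by (intro map_subst_trm_cong) (auto simp: linear_Cons)
  ultimately show ?case
    using * by (intro exI[of _ ?\<rho>]) simp
qed

lemma variables_match:
  assumes "linear vs" "\<forall>v\<in>set vs. is_variable v" "length vs = length ss"
  shows "\<exists>\<sigma>. map (subst_trm \<sigma>) vs = ss"
proof (rule linear_match[OF assms(1)])
  have "\<exists>\<sigma>. subst_trm \<sigma> v = s" if "is_variable v" for v s :: "('a, 'b) trm"
    using that by (auto simp: is_variable_iff intro: exI[of _ "\<lambda>_. s"])
  then show "list_all2 (\<lambda>v s. \<exists>\<sigma>. subst_trm \<sigma> v = s) vs ss"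
    using assms(2,3) by (simp add: list_all2_conv_all_nth)
qed

text \<open>A unifier shows that two non-variable terms have the same function symbol and number of
  arguments. The distinct variables below the symbol of \<open>v\<close> can then be sent to the
  arguments of \<open>s\<close>, whatever \<open>\<theta>\<close> does.\<close>

lemma flat_match:
  assumes "flat v" "is_variable v \<or> \<not> is_variable s" "subst_trm \<theta> s = subst_trm \<theta> v"
  shows "\<exists>\<sigma>. subst_trm \<sigma> v = s"
proof (cases v)
  case (Var x)
  then show ?thesis by (auto intro: exI[of _ "\<lambda>_. s"])
next
  case (Fun f vs)
  then obtain xs where xs: "distinct xs" "vs = map Var xs"
    using assms(1) by (auto simp: flat_def)
  obtain ts where ts: "s = Fun f ts" "length ts = length xs"
    using assms(2,3) Fun xs by (cases s) (auto dest: map_eq_imp_length_eq)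
  have "\<exists>\<sigma>. map (subst_trm \<sigma>) (map Var xs) = ts"
    using xs ts by (intro variables_match) auto
  then show ?thesis
    using Fun xs ts by auto
qed

section \<open>Input and output arguments of atoms\<close>

lemma select_Nil [simp]: "select m [] xs = []" "select m ms [] = []"
  by (simp_all add: select_def)

lemma select_Cons [simp]:
  "select m (m' # ms) (x # xs) = (if m' = m then x # select m ms xs else select m ms xs)"
  by (simp add: select_def)

lemma select_map: "select m ms (map f xs) = map f (select m ms xs)"
proof (induction ms arbitrary: xs)
  case (Cons m' ms)
  then show ?case by (cases xs) auto
qed simp

lemma set_select_subset: "set (select m ms xs) \<subseteq> set xs"
  by (auto simp: select_def dest: set_zip_rightD)

lemma list_all2_select:
  assumes "length xs = length ms" "length ys = length ms"
  shows "list_all2 R (select m ms xs) (select m ms ys) \<longleftrightarrow>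
           (\<forall>i<length ms. ms ! i = m \<longrightarrow> R (xs ! i) (ys ! i))"
  using assms
proof (induction ms arbitrary: xs ys)
  case (Cons m' ms)
  then obtain x xs' y ys' where "xs = x # xs'" "ys = y # ys'"
    by (cases xs; cases ys) auto
  with Cons show ?case
    by (auto simp: All_less_Suc2)
qed simp

lemma set_select_iff:
  assumes "length xs = length ms"
  shows "(\<forall>x\<in>set (select m ms xs). R x) \<longleftrightarrow> (\<forall>i<length ms. ms ! i = m \<longrightarrow> R (xs ! i))"
  using list_all2_select[OF assms assms, of "\<lambda>x _. R x" m]
  by (auto simp: list_all2_same)

text \<open>Every mode is \<open>Input\<close> or \<open>Output\<close>, so each position is covered
  by one of the two selections.\<close>

lemma select_Input_Output_eq:
  assumes "length xs = length ms" "length ys = length ms"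
    and "select Input ms xs = select Input ms ys" "select Output ms xs = select Output ms ys"
  shows "xs = ys"
proof (rule nth_equalityI)
  fix i assume "i < length xs"
  moreover have "list_all2 (=) (select m ms xs) (select m ms ys)" for m
    using assms(3,4) by (cases m) (simp_all add: list.rel_eq)
  ultimately show "xs ! i = ys ! i"
    using assms(1,2) by (simp add: list_all2_select)
qed (use assms in simp)

lemma psym_subst_atom [simp]: "psym (subst_atom \<sigma> a) = psym a"
  by (simp add: subst_atom_def)

lemma ins_subst_atom [simp]: "ins P (subst_atom \<sigma> a) = map (subst_trm \<sigma>) (ins P a)"
  by (simp add: ins_def subst_atom_def select_map)

lemma outs_subst_atom [simp]: "outs P (subst_atom \<sigma> a) = map (subst_trm \<sigma>) (outs P a)"
  by (simp add: outs_def subst_atom_def select_map)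

lemma in_types_subst_atom [simp]: "in_types P (subst_atom \<sigma> a) = in_types P a"
  by (simp add: in_types_def)

lemma out_types_subst_atom [simp]: "out_types P (subst_atom \<sigma> a) = out_types P a"
  by (simp add: out_types_def)

lemma wf_atom_subst_atom [simp]: "wf_atom P (subst_atom \<sigma> a) \<longleftrightarrow> wf_atom P a"
  by (simp add: wf_atom_def subst_atom_def)

lemma vars_select_subset: "vars (select m ms ts) \<subseteq> vars ts"
  unfolding vars_def by (intro UN_mono set_select_subset order_refl)

lemma vars_ins_subset: "vars (ins P a) \<subseteq> vars (args a)"
  unfolding ins_def by (rule vars_select_subset)

lemma vars_outs_subset: "vars (outs P a) \<subseteq> vars (args a)"
  unfolding outs_def by (rule vars_select_subset)

text \<open>Allows a unifier to be checked on inputs and outputs separately.\<close>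

lemma atom_eqI:
  assumes "psym a = psym b" "wf_atom P a" "wf_atom P b" "ins P a = ins P b" "outs P a = outs P b"
  shows "a = b"
proof (cases a, cases b)
  fix p xs q ys assume ab: "a = Atom p xs" "b = Atom q ys"
  have "xs = ys"
    by (rule select_Input_Output_eq[where ms = "mode P p"])
      (use assms in \<open>simp_all add: ab ins_def outs_def wf_atom_def arity_def\<close>)
  then show "a = b"
    using assms(1) ab by simp
qed


section \<open>Queries in producer--consumer order\<close>

text \<open>Not symmetric: in a list sorted by it, an earlier atom never consumes what a later one
  produces, but a later atom may consume what an earlier one produces.\<close>

definition indep :: "('p, 'f, 'v) program \<Rightarrow> ('p, 'f, 'v) atom \<Rightarrow> ('p, 'f, 'v) atom \<Rightarrow> bool" where
  "indep P a b \<longleftrightarrow> vars (ins P a) \<inter> vars (outs P b) = {}"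

definition ins_typed ::
    "('p, 'f, 'v) program \<Rightarrow> ('f, 'v) subst \<Rightarrow> ('p, 'f, 'v) atom \<Rightarrow> bool" where
  "ins_typed P \<sigma> a \<longleftrightarrow> has_types (map (subst_trm \<sigma>) (ins P a)) (in_types P a)"

definition outs_typed ::
    "('p, 'f, 'v) program \<Rightarrow> ('f, 'v) subst \<Rightarrow> ('p, 'f, 'v) atom \<Rightarrow> bool" where
  "outs_typed P \<sigma> a \<longleftrightarrow> has_types (map (subst_trm \<sigma>) (outs P a)) (out_types P a)"

abbreviation out_terms :: "('p, 'f, 'v) program \<Rightarrow> ('p, 'f, 'v) query \<Rightarrow> ('f, 'v) trm list" where
  "out_terms P L \<equiv> concat (map (outs P) L)"

text \<open>\<open>sorted_wrt\<close> compares different positions only; the last conjunct adds the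
  case \<open>i = j\<close> of nicely moded queries, that no atom consumes its own output.\<close>

definition moded_sequence :: "('p, 'f, 'v) program \<Rightarrow> ('p, 'f, 'v) query \<Rightarrow> bool" where
  "moded_sequence P L \<longleftrightarrow>
     wf_query P L \<and> (\<forall>t\<in>set (out_terms P L). is_variable t) \<and> linear (out_terms P L) \<and>
     sorted_wrt (indep P) L \<and> (\<forall>a\<in>set L. indep P a a)"

text \<open>The substitution is fixed, and the typing of the outputs of \<open>a\<close> is a
  premise for everything after \<open>a\<close>. In this form the condition splits along append,
  which is what replacing an atom by a clause body requires.\<close>

fun typed_sequence ::
    "('p, 'f, 'v) program \<Rightarrow> ('f, 'v) subst \<Rightarrow> ('p, 'f, 'v) query \<Rightarrow> bool" where
  "typed_sequence P \<sigma> [] \<longleftrightarrow> True"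
| "typed_sequence P \<sigma> (a # L) \<longleftrightarrow>
     ins_typed P \<sigma> a \<and> (outs_typed P \<sigma> a \<longrightarrow> typed_sequence P \<sigma> L)"

lemma typed_sequence_append:
  "typed_sequence P \<sigma> (L @ M) \<longleftrightarrow>
     typed_sequence P \<sigma> L \<and> ((\<forall>a\<in>set L. outs_typed P \<sigma> a) \<longrightarrow> typed_sequence P \<sigma> M)"
  by (induction L) auto

lemma typed_sequence_iff_nth:
  "typed_sequence P \<sigma> L \<longleftrightarrow>
     (\<forall>i<length L. (\<forall>j<i. outs_typed P \<sigma> (L ! j)) \<longrightarrow> ins_typed P \<sigma> (L ! i))"
  by (induction L) (auto simp: All_less_Suc2)

lemma ins_typed_subst [simp]:
  "ins_typed P \<sigma> (subst_atom \<theta> a) \<longleftrightarrow> ins_typed P (subst_comp \<theta> \<sigma>) a"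
  by (simp add: ins_typed_def comp_def)

lemma outs_typed_subst [simp]:
  "outs_typed P \<sigma> (subst_atom \<theta> a) \<longleftrightarrow> outs_typed P (subst_comp \<theta> \<sigma>) a"
  by (simp add: outs_typed_def comp_def)

lemma typed_sequence_subst [simp]:
  "typed_sequence P \<sigma> (subst_query \<theta> L) \<longleftrightarrow> typed_sequence P (subst_comp \<theta> \<sigma>) L"
  by (induction L) (simp_all add: subst_query_def)

lemma ball_outs_typed_subst_query:
  "(\<forall>b\<in>set (subst_query \<theta> L). outs_typed P \<sigma> b) \<longleftrightarrow>
     (\<forall>b\<in>set L. outs_typed P (subst_comp \<theta> \<sigma>) b)"
  by (simp add: subst_query_def)

lemma out_terms_subst_query: "out_terms P (subst_query \<theta> L) = map (subst_trm \<theta>) (out_terms P L)"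
  by (induction L) (simp_all add: subst_query_def)

text \<open>Linearity is distinctness of the list of variable occurrences. This depends only on
  their multiset, which is a sum over the atoms.\<close>

lemma linear_out_terms_mset:
  assumes "mset L = mset Q" "linear (out_terms P Q)"
  shows "linear (out_terms P L)"
proof -
  have *: "mset (concat (map var_occs (out_terms P M))) =
      (\<Sum>a\<in>#mset M. mset (concat (map var_occs (outs P a))))" for M
    by (induction M) simp_all
  have "mset (concat (map var_occs (out_terms P L))) = mset (concat (map var_occs (out_terms P Q)))"
    unfolding * using assms(1) by simp
  then show ?thesis
    using assms(2) unfolding linear_def by (metis mset_eq_imp_distinct_iff)
qed

text \<open>If \<open>\<theta>\<close> composed with some \<open>\<delta>\<close> fixes the output variables, then \<open>\<theta>\<close> renames them
  injectively, and the modes only have to be checked for \<open>subst_comp \<theta> \<delta>\<close>.\<close>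

lemma moded_sequence_subst:
  assumes wf: "wf_query P L" and var: "\<forall>t\<in>set (out_terms P L). is_variable t"
    and lin: "linear (out_terms P L)"
    and fixed: "\<And>y. y \<in> vars (out_terms P L) \<Longrightarrow> subst_comp \<theta> \<delta> y = Var y"
    and sorted: "sorted_wrt (indep P) (subst_query (subst_comp \<theta> \<delta>) L)"
    and refl: "\<And>a. a \<in> set L \<Longrightarrow> indep P (subst_atom (subst_comp \<theta> \<delta>) a) (subst_atom (subst_comp \<theta> \<delta>) a)"
  shows "moded_sequence P (subst_query \<theta> L)"
proof -
  obtain ys where ys: "out_terms P L = map Var ys"
    using var by (rule all_variables_obtain)
  have ren: "subst_trm \<delta> (\<theta> y) = Var y" if "y \<in> set ys" for y
    using fixed[of y] that ys by (simp add: subst_comp_def)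
  \<comment> \<open>No substitution turns a term with a function symbol at the root into a variable,
    so \<open>\<theta> y\<close> is a variable already.\<close>
  have "\<exists>z. \<theta> y = Var z" if "y \<in> set ys" for y
    using ren[OF that] by (cases "\<theta> y") auto
  then obtain \<rho> where \<rho>: "\<And>y. y \<in> set ys \<Longrightarrow> \<theta> y = Var (\<rho> y)"
    by metis
  have out: "out_terms P (subst_query \<theta> L) = map Var (map \<rho> ys)"
    using \<rho> by (simp add: out_terms_subst_query ys)
  have inj: "inj_on \<rho> (set ys)"
  proof (rule inj_onI)
    fix x y assume "x \<in> set ys" "y \<in> set ys" "\<rho> x = \<rho> y"
    then show "x = y"
      using ren[of x] ren[of y] \<rho> by simp
  qed
  have indep: "indep P (subst_atom \<theta> a) (subst_atom \<theta> b)"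
    if ab: "a \<in> set L" "b \<in> set L"
      and *: "indep P (subst_atom (subst_comp \<theta> \<delta>) a) (subst_atom (subst_comp \<theta> \<delta>) b)" for a b
  proof (rule ccontr)
    assume "\<not> ?thesis"
    then obtain x y z where xyz: "x \<in> vars (ins P a)" "z \<in> set (var_occs (\<theta> x))"
        "y \<in> vars (outs P b)" "z \<in> set (var_occs (\<theta> y))"
      by (auto simp: indep_def vars_map_subst)
    have "y \<in> vars (out_terms P L)"
      using xyz(3) ab(2) by (auto simp: vars_concat)
    then have y: "y \<in> set ys" and fy: "subst_comp \<theta> \<delta> y = Var y"
      using ys fixed by auto
    \<comment> \<open>The shared variable \<open>z\<close> is the new name of the output variable
      \<open>y\<close>. Since \<open>\<delta>\<close> takes it back to \<open>y\<close>, the clash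
      would already be visible for the composition.\<close>
    have "\<delta> z = Var y"
      using \<rho>[OF y] xyz(4) ren[OF y] by simp
    then have "y \<in> set (var_occs (subst_comp \<theta> \<delta> x))"
      using xyz(2) by (force simp: subst_comp_def set_var_occs_subst)
    then have "y \<in> vars (ins P (subst_atom (subst_comp \<theta> \<delta>) a))"
      using xyz(1) by (auto simp: vars_map_subst)
    moreover have "y \<in> vars (outs P (subst_atom (subst_comp \<theta> \<delta>) b))"
      using xyz(3) fy by (force simp: vars_map_subst)
    ultimately show False
      using * by (auto simp: indep_def)
  qed
  have "wf_query P (subst_query \<theta> L)"
    using wf by (simp add: wf_query_def subst_query_def)
  moreover have "sorted_wrt (indep P) (subst_query \<theta> L)"
    using sorted unfolding subst_query_def sorted_wrt_map
    by (rule sorted_wrt_mono_rel[rotated]) (rule indep)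
  moreover have "\<forall>a\<in>set (subst_query \<theta> L). indep P a a"
    using indep refl by (auto simp: subst_query_def)
  ultimately show ?thesis
    using inj lin unfolding moded_sequence_def out ys
    by (auto simp only: linear_map_Var distinct_map) auto
qed

section \<open>From permutations to ordered lists\<close>

text \<open>The list is obtained by reading the atoms in the order given by \<open>\<pi>\<close>.
  Typing is left as an implication for each \<open>\<sigma>\<close>, so that queries and clause
  bodies can both supply its premise; for a body the typed head input serves as a further
  assumption.\<close>

lemma permutation_ordering:
  assumes \<pi>: "\<pi> permutes {1..length Q}"
    and nm: "nicely_moded_query P \<pi> Q"
  shows "\<exists>L. mset L = mset Q \<and> sorted_wrt (indep P) L \<and> (\<forall>a\<in>set L. indep P a a) \<and>
           (\<forall>\<sigma>. (\<forall>i\<in>{1..length Q}.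
                   (\<forall>j\<in>{1..length Q}. \<pi> j < \<pi> i \<longrightarrow> outs_typed P \<sigma> (nth_atom Q j)) \<longrightarrow>
                   ins_typed P \<sigma> (nth_atom Q i)) \<longrightarrow> typed_sequence P \<sigma> L)"
proof -
  define n where "n = length Q"
  \<comment> \<open>Index \<open>i\<close> of \<open>L\<close> holds the atom that
    \<open>\<pi>\<close> moves to place \<open>i + 1\<close>: \<open>\<pi>\<close> counts from 1,
    lists count from 0.\<close>
  define L where "L = map (\<lambda>i. nth_atom Q (inv \<pi> (Suc i))) [0..<n]"
  have inv: "inv \<pi> permutes {1..n}"
    using \<pi> by (simp add: n_def permutes_inv)
  have in_range: "inv \<pi> (Suc i) \<in> {1..n}" if "i < n" for i
    using permutes_in_image[OF inv, of "Suc i"] that by simp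
  have \<pi>_inv: "\<pi> (inv \<pi> i) = i" for i
    using \<pi> by (rule permutes_inverses)
  have inv_\<pi>: "inv \<pi> (\<pi> i) = i" for i
    using \<pi> by (rule permutes_inverses)
  have L_nth: "L ! i = nth_atom Q (inv \<pi> (Suc i))" if "i < n" for i
    using that by (simp add: L_def)
  have len: "length L = n"
    by (simp add: L_def)
  have indep: "indep P (L ! i) (L ! j)" if "i \<le> j" "j < n" for i j
  proof -
    have "vars (ins P (nth_atom Q i')) \<inter> vars (outs P (nth_atom Q j')) = {}"
      if "i' \<in> {1..n}" "j' \<in> {1..n}" "\<pi> i' \<le> \<pi> j'" "\<pi> j' \<le> n" for i' j'
      using nm that unfolding nicely_moded_query_def n_def by blast
    from this[of "inv \<pi> (Suc i)" "inv \<pi> (Suc j)"] that show ?thesis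
      using in_range by (simp add: indep_def L_nth \<pi>_inv)
  qed
  have "mset L = image_mset (\<lambda>i. nth_atom Q i) (mset (map (inv \<pi>) [1..<Suc n]))"
    unfolding L_def by (simp add: map_Suc_upt[symmetric] comp_def multiset.map_comp del: upt_Suc map_Suc_upt)
  \<comment> \<open>Both lists enumerate \<open>{1..n}\<close> without repetition.\<close>
  also have "mset (map (inv \<pi>) [1..<Suc n]) = mset [1..<Suc n]"
  proof -
    have "set (map (inv \<pi>) [1..<Suc n]) = {1..n}"
      using permutes_image[OF inv] by (simp add: atLeastLessThanSuc_atLeastAtMost del: upt_Suc)
    moreover have "distinct (map (inv \<pi>) [1..<Suc n])"
      using permutes_inj_on[OF inv] by (simp add: distinct_map del: upt_Suc)
    ultimately show ?thesis
      by (subst set_eq_iff_mset_eq_distinct[symmetric]) (auto simp del: upt_Suc)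
  qed
  also have "image_mset (\<lambda>i. nth_atom Q i) (mset [1..<Suc n]) = mset Q"
  proof -
    have "map (nth_atom Q) [1..<Suc n] = Q"
      by (rule nth_equalityI) (auto simp: n_def simp del: upt_Suc)
    then show ?thesis
      by (metis mset_map)
  qed
  finally have "mset L = mset Q" .
  moreover have "sorted_wrt (indep P) L"
    using indep by (simp add: sorted_wrt_iff_nth_less len)
  moreover have "\<forall>a\<in>set L. indep P a a"
    using indep by (auto simp: in_set_conv_nth len)
  moreover have "typed_sequence P \<sigma> L"
    if wtd: "\<forall>i\<in>{1..length Q}.
          (\<forall>j\<in>{1..length Q}. \<pi> j < \<pi> i \<longrightarrow> outs_typed P \<sigma> (nth_atom Q j)) \<longrightarrow>
          ins_typed P \<sigma> (nth_atom Q i)" for \<sigma>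
    unfolding typed_sequence_iff_nth len
  proof (intro allI impI)
    fix i assume i: "i < n" and *: "\<forall>j<i. outs_typed P \<sigma> (L ! j)"
    have "outs_typed P \<sigma> (nth_atom Q j)" if "j \<in> {1..n}" "\<pi> j < Suc i" for j
    proof -
      have "\<pi> j \<in> {1..n}"
        using permutes_in_image[OF \<pi>] that(1) by (simp add: n_def)
      \<comment> \<open>Atom number \<open>j\<close> stands at index \<open>\<pi> j - 1\<close> of
        \<open>L\<close>, which is less than \<open>i\<close>.\<close>
      then show ?thesis
        using *[rule_format, of "\<pi> j - 1"] L_nth[of "\<pi> j - 1"] that i by (simp add: inv_\<pi>)
    qed
    then show "ins_typed P \<sigma> (L ! i)"
      using wtd[rule_format, of "inv \<pi> (Suc i)"] in_range[OF i] i
      by (simp add: L_nth \<pi>_inv n_def)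
  qed
  ultimately show ?thesis
    by blast
qed

definition simply_typed_sequence :: "('p, 'f, 'v) program \<Rightarrow> ('p, 'f, 'v) query \<Rightarrow> bool" where
  "simply_typed_sequence P L \<longleftrightarrow> moded_sequence P L \<and> (\<forall>\<sigma>. typed_sequence P \<sigma> L)"

lemma mset_moded_sequenceI:
  assumes L: "mset L = mset Q" "sorted_wrt (indep P) L" "\<forall>a\<in>set L. indep P a a"
    and Q: "wf_query P Q" "\<forall>a\<in>set Q. \<forall>t\<in>set (outs P a). is_variable t" "linear (out_terms P Q)"
  shows "moded_sequence P L"
  using L Q linear_out_terms_mset[OF L(1) Q(3)] mset_eq_setD[OF L(1)]
  by (simp add: moded_sequence_def wf_query_def)

lemma ex_simply_typed_sequence:
  assumes "wf_query P Q" "permutation_simply_typed_query P Q"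
  shows "\<exists>L. mset L = mset Q \<and> simply_typed_sequence P L"
proof -
  obtain \<pi> where \<pi>: "\<pi> permutes {1..length Q}" "nicely_moded_query P \<pi> Q" "well_typed_query P \<pi> Q"
      "\<forall>a\<in>set Q. \<forall>t\<in>set (outs P a). is_variable t"
    using assms(2) by (auto simp: permutation_simply_typed_query_def simply_typed_query_def)
  obtain L where L: "mset L = mset Q" "sorted_wrt (indep P) L" "\<forall>a\<in>set L. indep P a a"
    and wtd: "\<And>\<sigma>. (\<forall>i\<in>{1..length Q}.
                   (\<forall>j\<in>{1..length Q}. \<pi> j < \<pi> i \<longrightarrow> outs_typed P \<sigma> (nth_atom Q j)) \<longrightarrow>
                   ins_typed P \<sigma> (nth_atom Q i)) \<Longrightarrow> typed_sequence P \<sigma> L"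
    using permutation_ordering[OF \<pi>(1,2)] by blast
  have "1 \<le> \<pi> j" if "j \<in> {1..length Q}" for j
    using permutes_in_image[OF \<pi>(1), of j] that by simp
  then have "typed_sequence P \<sigma> L" for \<sigma>
    using \<pi>(3) by (intro wtd) (simp add: well_typed_query_def ins_typed_def outs_typed_def)
  moreover have "moded_sequence P L"
    using L assms(1) \<pi>(2,4) by (intro mset_moded_sequenceI) (auto simp: nicely_moded_query_def)
  ultimately show ?thesis
    using L(1) by (auto simp: simply_typed_sequence_def)
qed

text \<open>A clause whose body is already listed in producer--consumer order. The typing flow
  starts at the head input, passes through the body atoms and ends at the head output.\<close>

definition simply_typed_rule ::
    "('p, 'f, 'v) program \<Rightarrow> ('p, 'f, 'v) atom \<Rightarrow> ('p, 'f, 'v) query \<Rightarrow> bool" where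
  "simply_typed_rule P h B \<longleftrightarrow>
     wf_atom P h \<and> linear (ins P h) \<and> (\<forall>t\<in>set (ins P h). flat t) \<and>
     moded_sequence P B \<and> vars (ins P h) \<inter> vars (out_terms P B) = {} \<and>
     (\<forall>\<sigma>. ins_typed P \<sigma> h \<longrightarrow>
        typed_sequence P \<sigma> B \<and> ((\<forall>b\<in>set B. outs_typed P \<sigma> b) \<longrightarrow> outs_typed P \<sigma> h))"

lemma ex_simply_typed_rule:
  assumes wf: "wf_atom P (head C)" "wf_query P (body C)" and lin: "linear (ins P (head C))"
    and \<pi>: "\<pi> permutes {1..length (body C)}" and C: "simply_typed_clause P \<pi> C"
  shows "\<exists>B. mset B = mset (body C) \<and> simply_typed_rule P (head C) B"
proof -
  let ?n = "length (body C)"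
  have nm: "nicely_moded_query P \<pi> (body C)"
    and disj: "vars (ins P (head C)) \<inter> (\<Union>j\<in>{1..?n}. vars (outs P (nth_atom (body C) j))) = {}"
    and wt: "well_typed_clause P \<pi> C"
    and var: "\<forall>a\<in>set (body C). \<forall>t\<in>set (outs P a). is_variable t"
    and flat: "\<forall>t\<in>set (ins P (head C)). flat t"
    using C by (auto simp: simply_typed_clause_def nicely_moded_clause_def
        list_all2_conv_all_nth in_set_conv_nth)
  obtain B where B: "mset B = mset (body C)" "sorted_wrt (indep P) B" "\<forall>a\<in>set B. indep P a a"
    and wtd: "\<And>\<sigma>. (\<forall>i\<in>{1..?n}.
                   (\<forall>j\<in>{1..?n}. \<pi> j < \<pi> i \<longrightarrow> outs_typed P \<sigma> (nth_atom (body C) j)) \<longrightarrow>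
                   ins_typed P \<sigma> (nth_atom (body C) i)) \<Longrightarrow> typed_sequence P \<sigma> B"
    using permutation_ordering[OF \<pi> nm] by blast
  have set_B: "set B = set (body C)"
    using B(1) by (rule mset_eq_setD)
  have "moded_sequence P B"
    using B wf(2) var nm by (intro mset_moded_sequenceI) (auto simp: nicely_moded_query_def)
  moreover have "vars (ins P (head C)) \<inter> vars (out_terms P B) = {}"
  proof -
    have "vars (out_terms P B) \<subseteq> (\<Union>j\<in>{1..?n}. vars (outs P (nth_atom (body C) j)))"
    proof
      fix x assume "x \<in> vars (out_terms P B)"
      then obtain i where "i < ?n" "x \<in> vars (outs P (body C ! i))"
        by (auto simp: vars_concat set_B in_set_conv_nth)
      then show "x \<in> (\<Union>j\<in>{1..?n}. vars (outs P (nth_atom (body C) j)))"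
        by (intro UN_I[of "Suc i"]) auto
    qed
    then show ?thesis
      using disj by blast
  qed
  moreover have "typed_sequence P \<sigma> B \<and> ((\<forall>b\<in>set B. outs_typed P \<sigma> b) \<longrightarrow> outs_typed P \<sigma> (head C))"
    if h: "ins_typed P \<sigma> (head C)" for \<sigma>
  proof -
    \<comment> \<open>The premise ranges over body atoms only; producer 0 is the head input, whose
      typing is \<open>h\<close>.\<close>
    have *: "has_types (map (subst_trm \<sigma>) (cons_terms P C i)) (cons_types P C i)"
      if "i \<in> {1..?n + 1}"
        and prem: "\<And>j. j \<in> {1..?n} \<Longrightarrow> \<pi> j < \<pi> i \<Longrightarrow> outs_typed P \<sigma> (nth_atom (body C) j)" for i
    proof -
      have "has_types (map (subst_trm \<sigma>) (prod_terms P C j)) (prod_types P C j)"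
        if "j \<in> {0..?n}" "\<pi> j < \<pi> i" for j
        using prem[of j] that h
        by (cases "j = 0") (auto simp: prod_terms_def prod_types_def outs_typed_def ins_typed_def)
      then show ?thesis
        using wt that(1) unfolding well_typed_clause_def by blast
    qed
    have "typed_sequence P \<sigma> B"
    proof (intro wtd ballI impI)
      fix i assume i: "i \<in> {1..?n}"
        and "\<forall>j\<in>{1..?n}. \<pi> j < \<pi> i \<longrightarrow> outs_typed P \<sigma> (nth_atom (body C) j)"
      then show "ins_typed P \<sigma> (nth_atom (body C) i)"
        using *[of i] by (simp add: cons_terms_def cons_types_def ins_typed_def)
    qed
    moreover have "outs_typed P \<sigma> (head C)" if "\<forall>b\<in>set B. outs_typed P \<sigma> b"
    proof -
      have "outs_typed P \<sigma> (nth_atom (body C) j)" if "j \<in> {1..?n}" for j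
      proof -
        have "nth_atom (body C) j \<in> set B"
          using that unfolding set_B by (intro nth_mem) auto
        then show ?thesis
          using \<open>\<forall>b\<in>set B. outs_typed P \<sigma> b\<close> by blast
      qed
      \<comment> \<open>Consumer \<open>?n + 1\<close> is the head output; all body outputs are
        typed, so its premise holds.\<close>
      then show ?thesis
        using *[of "?n + 1"] by (simp add: cons_terms_def cons_types_def outs_typed_def)
    qed
    ultimately show ?thesis
      by blast
  qed
  ultimately have "simply_typed_rule P (head C) B"
    using wf(1) lin flat by (simp add: simply_typed_rule_def)
  then show ?thesis
    using B(1) by blast
qed

section \<open>Renaming of clauses\<close>

lemma var_occs_rename: "var_occs (subst_trm (\<lambda>x. Var (\<rho> x)) t) = map \<rho> (var_occs t)"
  by (induction t) (auto simp: map_concat comp_def cong: map_cong)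

lemma linear_rename:
  assumes "inj \<rho>" "linear ts"
  shows "linear (map (subst_trm (\<lambda>x. Var (\<rho> x))) ts)"
proof -
  have "concat (map var_occs (map (subst_trm (\<lambda>x. Var (\<rho> x))) ts)) =
      map \<rho> (concat (map var_occs ts))"
    by (simp add: var_occs_rename map_concat comp_def)
  then show ?thesis
    using assms by (simp only: linear_def distinct_map) (auto intro: inj_on_subset)
qed

lemma flat_rename:
  assumes "inj \<rho>" "flat t"
  shows "flat (subst_trm (\<lambda>x. Var (\<rho> x)) t)"
proof (cases t)
  case (Fun f ts)
  then obtain xs where "distinct xs" "ts = map Var xs"
    using assms(2) by (auto simp: flat_def)
  then show ?thesis
    using Fun assms(1) unfolding flat_def
    by (auto simp: distinct_map comp_def intro!: exI[of _ "map \<rho> xs"] intro: inj_on_subset[OF _ subset_UNIV])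
qed (simp add: flat_def)

text \<open>This applies \<open>moded_sequence_subst\<close> with the inverse renaming as
  \<open>\<delta>\<close>: the composition is the identity, so the modes to be checked are those of
  \<open>B\<close>. The typing conditions carry over because they hold for all
  substitutions.\<close>

lemma simply_typed_rule_rename:
  fixes P :: "('p, 'f, 'v) program"
  assumes "bij \<rho>" and rule: "simply_typed_rule P h B"
  shows "simply_typed_rule P (subst_atom (\<lambda>x. Var (\<rho> x)) h) (subst_query (\<lambda>x. Var (\<rho> x)) B)"
proof -
  let ?\<rho> = "\<lambda>x. Var (\<rho> x) :: ('f, 'v) trm"
  have inj: "inj \<rho>"
    using assms(1) by (rule bij_is_inj)
  have id: "subst_comp ?\<rho> (\<lambda>x. Var (inv \<rho> x)) = Var"
    using inj by (simp add: subst_comp_def)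
  have [simp]: "subst_atom Var a = a" for a :: "('p, 'f, 'v) atom"
    by (cases a) (simp add: subst_atom_def map_idI)
  have [simp]: "subst_query Var L = L" for L :: "('p, 'f, 'v) query"
    by (simp add: subst_query_def map_idI)
  have "moded_sequence P (subst_query ?\<rho> B)"
    using rule by (intro moded_sequence_subst[where \<delta> = "\<lambda>x. Var (inv \<rho> x)"])
      (auto simp: id simply_typed_rule_def moded_sequence_def)
  moreover have "vars (ins P (subst_atom ?\<rho> h)) \<inter> vars (out_terms P (subst_query ?\<rho> B)) = {}"
    using rule inj unfolding simply_typed_rule_def
    by (auto simp: out_terms_subst_query vars_map_subst simp del: set_concat dest: injD)
  ultimately show ?thesis
    using rule unfolding simply_typed_rule_def
    by (simp add: ball_outs_typed_subst_query linear_rename[OF inj] flat_rename[OF inj])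
qed


section \<open>Resolution steps\<close>

lemma vars_out_terms_subset: "vars (out_terms P L) \<subseteq> vars_query L"
  using vars_outs_subset[of P] by (auto simp: vars_query_def vars_concat)

text \<open>For the typing it is enough that \<open>\<theta>\<close> unifies \<open>a\<close> and
  \<open>h\<close>. For the modes, a concrete unifier \<open>\<eta>\<close> is built that fixes the
  output variables of \<open>L\<close>, \<open>B\<close> and \<open>M\<close>. It factors through
  the mgu, so \<open>moded_sequence_subst\<close> carries independence from \<open>\<eta>\<close>
  back to \<open>\<theta>\<close>.\<close>

lemma simply_typed_resolvent:
  assumes seq: "simply_typed_sequence P (L @ a # M)"
    and rule: "simply_typed_rule P h B"
    and match: "list_all2 (\<lambda>v s. \<exists>\<sigma>. subst_trm \<sigma> v = s) (ins P h) (ins P a)"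
    and apart: "vars_query (h # B) \<inter> vars_query (L @ a # M) = {}"
    and mgu: "is_mgu \<theta> a h"
  shows "simply_typed_sequence P (subst_query \<theta> (L @ B @ M))"
proof -
  have unif: "subst_atom \<theta> a = subst_atom \<theta> h"
    using mgu by (simp add: is_mgu_def)
  then have psym: "psym a = psym h"
    by (metis psym_subst_atom)
  have wf_h: "wf_atom P h" and lin_h: "linear (ins P h)"
    and mod_B: "moded_sequence P B" and disj_h: "vars (ins P h) \<inter> vars (out_terms P B) = {}"
    and typ_B: "\<And>\<sigma>. ins_typed P \<sigma> h \<Longrightarrow> typed_sequence P \<sigma> B"
    and typ_h: "\<And>\<sigma>. ins_typed P \<sigma> h \<Longrightarrow> \<forall>b\<in>set B. outs_typed P \<sigma> b \<Longrightarrow> outs_typed P \<sigma> h"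
    using rule by (auto simp: simply_typed_rule_def)
  have mod_L: "moded_sequence P (L @ a # M)" and typ_L: "\<And>\<sigma>. typed_sequence P \<sigma> (L @ a # M)"
    using seq by (auto simp: simply_typed_sequence_def)
  have wf_a: "wf_atom P a"
    using mod_L by (simp add: moded_sequence_def wf_query_def)
  have lin_a: "linear (outs P a)"
    using mod_L by (simp add: moded_sequence_def linear_append)

  have in_eq: "ins_typed P (subst_comp \<theta> \<sigma>) a \<longleftrightarrow> ins_typed P (subst_comp \<theta> \<sigma>) h" for \<sigma>
    using arg_cong[OF unif, of "ins_typed P \<sigma>"] by simp
  have out_eq: "outs_typed P (subst_comp \<theta> \<sigma>) a \<longleftrightarrow> outs_typed P (subst_comp \<theta> \<sigma>) h" for \<sigma>
    using arg_cong[OF unif, of "outs_typed P \<sigma>"] by simp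
  \<comment> \<open>Under \<open>subst_comp \<theta> \<sigma>\<close> the atoms \<open>a\<close> and
    \<open>h\<close> are typed alike. If the outputs of \<open>L\<close> are typed, so are the
    inputs of \<open>a\<close> and of \<open>h\<close>, which types the body; typed body outputs
    give typed outputs of \<open>h\<close>, hence of \<open>a\<close>, as \<open>M\<close> may
    assume.\<close>
  have typed: "typed_sequence P \<sigma> (subst_query \<theta> (L @ B @ M))" for \<sigma>
    using typ_L[of "subst_comp \<theta> \<sigma>"] typ_B[of "subst_comp \<theta> \<sigma>"] typ_h[of "subst_comp \<theta> \<sigma>"]
    by (auto simp: typed_sequence_append in_eq out_eq)

  let ?V = "vars (ins P h)" and ?T = "vars (outs P a)" and ?S = "vars (ins P a)"
  have sub: "?V \<subseteq> vars_query (h # B)" "vars (outs P h) \<subseteq> vars_query (h # B)"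
    "vars (out_terms P B) \<subseteq> vars_query (h # B)"
    "?T \<subseteq> vars_query (L @ a # M)" "?S \<subseteq> vars_query (L @ a # M)"
    "vars (out_terms P L) \<subseteq> vars_query (L @ a # M)" "vars (out_terms P M) \<subseteq> vars_query (L @ a # M)"
    using vars_ins_subset[of P h] vars_outs_subset[of P h] vars_ins_subset[of P a]
      vars_outs_subset[of P a] vars_out_terms_subset[of P B] vars_out_terms_subset[of P L]
      vars_out_terms_subset[of P M]
    by (auto simp: vars_query_def)
  have sub_B: "vars (ins P b) \<subseteq> vars_query (h # B)" "vars (outs P b) \<subseteq> vars_query (h # B)"
    if "b \<in> set B" for b
    using vars_ins_subset[of P b] vars_outs_subset[of P b] that by (auto simp: vars_query_def)
  have sub_LM: "vars (ins P b) \<subseteq> vars_query (L @ a # M)" "vars (outs P b) \<subseteq> vars_query (L @ a # M)"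
    if "b \<in> set L \<union> set M" for b
    using vars_ins_subset[of P b] vars_outs_subset[of P b] that by (auto simp: vars_query_def)
  have ST: "?S \<inter> ?T = {}"
    using mod_L by (simp add: moded_sequence_def indep_def)

  obtain \<alpha> where \<alpha>: "map (subst_trm \<alpha>) (ins P h) = ins P a"
    using linear_match[OF lin_h match] by blast
  \<comment> \<open>Restricting \<open>\<alpha>\<close> to the head input variables leaves all other
    variables of the head output in place.\<close>
  define \<alpha>' where "\<alpha>' x = (if x \<in> ?V then \<alpha> x else Var x)" for x
  have "\<exists>\<beta>. map (subst_trm \<beta>) (outs P a) = map (subst_trm \<alpha>') (outs P h)"
  proof (rule variables_match[OF lin_a])
    show "length (outs P a) = length (map (subst_trm \<alpha>') (outs P h))"
      using arg_cong[OF unif, of "\<lambda>a. length (outs P a)"] by simp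
    show "\<forall>t\<in>set (outs P a). is_variable t"
      using mod_L by (simp add: moded_sequence_def)
  qed
  then obtain \<beta> where \<beta>: "map (subst_trm \<beta>) (outs P a) = map (subst_trm \<alpha>') (outs P h)"
    by blast
  \<comment> \<open>\<open>?V\<close> and \<open>?T\<close> are disjoint by renaming apart, so the
    two matchers do not interfere. The input of \<open>a\<close> is left unchanged because
    \<open>?S\<close> avoids both sets.\<close>
  define \<eta> where "\<eta> x = (if x \<in> ?V then \<alpha> x else if x \<in> ?T then \<beta> x else Var x)" for x
  have "subst_atom \<eta> a = subst_atom \<eta> h"
  proof (rule atom_eqI)
    have "map (subst_trm \<eta>) (ins P a) = map (subst_trm Var) (ins P a)"
      using apart sub ST by (intro map_subst_trm_cong) (auto simp: \<eta>_def)
    moreover have "map (subst_trm \<eta>) (ins P h) = map (subst_trm \<alpha>) (ins P h)"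
      by (intro map_subst_trm_cong) (auto simp: \<eta>_def)
    ultimately show "ins P (subst_atom \<eta> a) = ins P (subst_atom \<eta> h)"
      using \<alpha> by (simp add: map_idI)
    have "map (subst_trm \<eta>) (outs P a) = map (subst_trm \<beta>) (outs P a)"
      using apart sub by (intro map_subst_trm_cong) (auto simp: \<eta>_def)
    moreover have "map (subst_trm \<eta>) (outs P h) = map (subst_trm \<alpha>') (outs P h)"
      using apart sub by (intro map_subst_trm_cong) (auto simp: \<eta>_def \<alpha>'_def)
    ultimately show "outs P (subst_atom \<eta> a) = outs P (subst_atom \<eta> h)"
      using \<beta> by simp
  qed (use psym wf_a wf_h in simp_all)
  then obtain \<delta> where \<delta>: "\<eta> = subst_comp \<theta> \<delta>"
    using mgu by (auto simp: is_mgu_def)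

  \<comment> \<open>The next two facts bound the variables that \<open>\<eta>\<close> can bring into
    an atom: those of the input of \<open>a\<close> and, in place of an output variable of
    \<open>a\<close>, also those of the head output.\<close>
  have \<eta>_V: "set (var_occs (\<eta> x)) \<subseteq> ?S" if "x \<in> ?V" for x
    using that arg_cong[OF \<alpha>, of vars] by (auto simp: \<eta>_def vars_map_subst)
  have \<eta>_T: "set (var_occs (\<eta> x)) \<subseteq> ?S \<union> vars (outs P h)" if "x \<in> ?T" for x
  proof -
    have "x \<notin> ?V"
      using that apart sub by blast
    then have "set (var_occs (\<eta> x)) \<subseteq> vars (map (subst_trm \<alpha>') (outs P h))"
      using that unfolding \<beta>[symmetric] by (auto simp: \<eta>_def vars_map_subst)
    also have "\<dots> \<subseteq> ?S \<union> vars (outs P h)"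
      using \<eta>_V by (fastforce simp: vars_map_subst \<alpha>'_def \<eta>_def split: if_splits)
    finally show ?thesis .
  qed
  have \<eta>_else: "\<eta> x = Var x" if "x \<notin> ?V" "x \<notin> ?T" for x
    using that by (simp add: \<eta>_def)

  let ?OL = "vars (out_terms P L)" and ?OM = "vars (out_terms P M)" and ?OB = "vars (out_terms P B)"
  have lin_L: "linear (out_terms P L)" "linear (out_terms P M)"
      "?OL \<inter> ?T = {}" "?OL \<inter> ?OM = {}" "?T \<inter> ?OM = {}"
    using mod_L unfolding moded_sequence_def
    by (simp_all only: map_append list.map concat_append concat.simps linear_append vars_append) blast+
  have apart_out: "?OL \<inter> ?OB = {}" "?OB \<inter> ?OM = {}" "?V \<inter> ?OL = {}" "?V \<inter> ?OM = {}" "?T \<inter> ?OB = {}"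
    using sub apart by blast+
  have vars_LBM: "vars (out_terms P (L @ B @ M)) = ?OL \<union> ?OB \<union> ?OM"
    by (simp only: map_append concat_append vars_append Un_assoc)
  have lin: "linear (out_terms P (L @ B @ M))"
  proof -
    have "linear (out_terms P B)"
      using mod_B by (simp add: moded_sequence_def)
    then show ?thesis
      using lin_L apart_out
      by (simp only: map_append concat_append linear_append vars_append Int_Un_distrib) simp
  qed
  \<comment> \<open>Outputs in \<open>L\<close> and \<open>M\<close> avoid \<open>?V\<close> by
    renaming apart and \<open>?T\<close> by linearity; outputs in \<open>B\<close> avoid
    \<open>?V\<close> because the clause is nicely moded and \<open>?T\<close> by renaming
    apart.\<close>
  have fixed: "\<eta> y = Var y" if "y \<in> vars (out_terms P (L @ B @ M))" for y
  proof (rule \<eta>_else)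
    show "y \<notin> ?V"
      using that disj_h apart_out(3,4) unfolding vars_LBM by blast
    show "y \<notin> ?T"
      using that lin_L(3,5) apart_out(5) unfolding vars_LBM by blast
  qed
  have fixed_outs: "vars (outs P (subst_atom \<eta> b)) = vars (outs P b)" if "b \<in> set (L @ B @ M)" for b
  proof -
    have "map (subst_trm \<eta>) (outs P b) = map (subst_trm Var) (outs P b)"
      using that by (intro map_subst_trm_cong fixed) (auto simp: vars_concat)
    then show ?thesis
      by (simp add: map_idI)
  qed
  have ins_\<eta>: "vars (ins P (subst_atom \<eta> c)) = (\<Union>x\<in>vars (ins P c). set (var_occs (\<eta> x)))" for c
    by (simp add: vars_map_subst)
  \<comment> \<open>Atoms before \<open>a\<close> do not consume its output and share no variable
    with the clause, so \<open>\<eta>\<close> does not touch their inputs.\<close>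
  have ins_L: "vars (ins P (subst_atom \<eta> c)) \<subseteq> vars (ins P c)" if "c \<in> set L" for c
  proof -
    have "vars (ins P c) \<inter> ?T = {}"
      using mod_L that by (simp add: moded_sequence_def indep_def sorted_wrt_append)
    moreover have "vars (ins P c) \<inter> ?V = {}"
      using sub_LM[of c] that sub apart by blast
    ultimately have "\<eta> x = Var x" if "x \<in> vars (ins P c)" for x
      using that by (intro \<eta>_else) auto
    then show ?thesis
      unfolding ins_\<eta> by auto
  qed
  \<comment> \<open>Body atoms may consume the head input, which \<open>\<eta>\<close> replaces by
    parts of the input of \<open>a\<close>.\<close>
  have ins_B: "vars (ins P (subst_atom \<eta> c)) \<subseteq> vars (ins P c) \<union> ?S" if "c \<in> set B" for c
  proof -
    have disj: "vars (ins P c) \<inter> ?T = {}"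
      using sub_B[of c] that sub apart by blast
    have "set (var_occs (\<eta> x)) \<subseteq> insert x ?S" if "x \<in> vars (ins P c)" for x
    proof -
      have "x \<notin> ?T"
        using that disj by blast
      then show ?thesis
        using \<eta>_V[of x] \<eta>_else[of x] by (cases "x \<in> ?V") auto
    qed
    then show ?thesis
      unfolding ins_\<eta> by blast
  qed
  \<comment> \<open>Atoms after \<open>a\<close> may consume its output, which \<open>\<eta>\<close>
    replaces by the instantiated head output.\<close>
  have ins_M: "vars (ins P (subst_atom \<eta> c)) \<subseteq> vars (ins P c) \<union> ?S \<union> vars (outs P h)"
    if "c \<in> set M" for c
  proof -
    have disj: "vars (ins P c) \<inter> ?V = {}"
      using sub_LM[of c] that sub apart by blast
    have "set (var_occs (\<eta> x)) \<subseteq> insert x (?S \<union> vars (outs P h))" if "x \<in> vars (ins P c)" for x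
    proof -
      have "x \<notin> ?V"
        using that disj by blast
      then show ?thesis
        using \<eta>_T[of x] \<eta>_else[of x] by (cases "x \<in> ?T") auto
    qed
    then show ?thesis
      unfolding ins_\<eta> by blast
  qed

  \<comment> \<open>The last premise concerns only \<open>d\<close> from the query; for
    \<open>d\<close> in the body it follows from renaming apart.\<close>
  have indep_L: "indep P (subst_atom \<eta> c) (subst_atom \<eta> d)"
    if "c \<in> set L" "d \<in> set (L @ B @ M)" "d \<in> set L \<union> set M \<Longrightarrow> indep P c d" for c d
    using ins_L[OF that(1)] fixed_outs[OF that(2)] that sub_LM[of c] sub_B[of d] apart
    unfolding indep_def by auto blast+
  \<comment> \<open>\<open>a\<close> precedes \<open>M\<close>, so its input avoids the outputs of
    \<open>M\<close>. Hence the variables brought in by \<open>\<eta>\<close> create no new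
    dependence on \<open>M\<close>.\<close>
  have S_M: "?S \<inter> vars (outs P d) = {}" if "d \<in> set M" for d
    using mod_L that by (simp add: moded_sequence_def indep_def sorted_wrt_append)
  have indep_B: "indep P (subst_atom \<eta> c) (subst_atom \<eta> d)"
    if "c \<in> set B" "d \<in> set B \<and> indep P c d \<or> d \<in> set M" for c d
  proof -
    have "vars (ins P c) \<inter> vars (outs P d) = {}"
      using that sub_B[of c] sub_LM[of d] apart unfolding indep_def by blast
    moreover have "?S \<inter> vars (outs P d) = {}"
      using that S_M[of d] sub_B[of d] sub apart by blast
    moreover have "vars (outs P (subst_atom \<eta> d)) = vars (outs P d)"
      using that fixed_outs[of d] by auto
    ultimately show ?thesis
      using ins_B[OF that(1)] unfolding indep_def by blast
  qed
  have indep_M: "indep P (subst_atom \<eta> c) (subst_atom \<eta> d)"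
    if "c \<in> set M" "d \<in> set M" "indep P c d" for c d
  proof -
    have "vars (outs P h) \<inter> vars (outs P d) = {}"
      using that sub_LM[of d] sub apart by blast
    moreover have "vars (outs P (subst_atom \<eta> d)) = vars (outs P d)"
      using that fixed_outs[of d] by auto
    ultimately show ?thesis
      using ins_M[OF that(1)] that(3) S_M[OF that(2)] unfolding indep_def by blast
  qed

  have "moded_sequence P (subst_query \<theta> (L @ B @ M))"
  \<comment> \<open>Folding the composition back into \<open>\<eta>\<close> turns the goals about
    modes into the independence facts collected above.\<close>
  proof (rule moded_sequence_subst[where \<delta> = \<delta>], unfold \<delta>[symmetric])
    show "wf_query P (L @ B @ M)"
      using mod_L mod_B by (auto simp: moded_sequence_def wf_query_def)
    show "\<forall>t\<in>set (out_terms P (L @ B @ M)). is_variable t"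
      using mod_L mod_B by (auto simp: moded_sequence_def)
    show "indep P (subst_atom \<eta> c) (subst_atom \<eta> c)" if "c \<in> set (L @ B @ M)" for c
    proof -
      have "\<forall>c\<in>set L \<union> set B \<union> set M. indep P c c"
        using mod_L mod_B by (auto simp: moded_sequence_def)
      then show ?thesis
        using that indep_L[of c c] indep_B[of c c] indep_M[of c c] by auto
    qed
    have "sorted_wrt (\<lambda>c d. indep P (subst_atom \<eta> c) (subst_atom \<eta> d)) L"
      by (rule sorted_wrt_mono_rel[where P = "indep P"])
        (use mod_L indep_L in \<open>auto simp: moded_sequence_def sorted_wrt_append\<close>)
    moreover have "sorted_wrt (\<lambda>c d. indep P (subst_atom \<eta> c) (subst_atom \<eta> d)) B"
      by (rule sorted_wrt_mono_rel[where P = "indep P"])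
        (use mod_B indep_B in \<open>auto simp: moded_sequence_def\<close>)
    moreover have "sorted_wrt (\<lambda>c d. indep P (subst_atom \<eta> c) (subst_atom \<eta> d)) M"
      by (rule sorted_wrt_mono_rel[where P = "indep P"])
        (use mod_L indep_M in \<open>auto simp: moded_sequence_def sorted_wrt_append\<close>)
    moreover have "indep P c d" if "c \<in> set L" "d \<in> set M" for c d
      using mod_L that by (simp add: moded_sequence_def sorted_wrt_append)
    moreover have "c \<notin> set L \<union> set M \<or> indep P c c" for c
      using mod_L by (auto simp: moded_sequence_def)
    moreover have "indep P (subst_atom \<eta> c) (subst_atom \<eta> d)" if "c \<in> set L" "d \<in> set B" for c d
    proof -
      have "vars (ins P c) \<inter> vars (outs P d) = {}"
        using that sub_LM[of c] sub_B[of d] apart by blast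
      then show ?thesis
        using indep_L[of c d] that by (simp add: indep_def)
    qed
    ultimately show "sorted_wrt (indep P) (subst_query \<eta> (L @ B @ M))"
      unfolding subst_query_def sorted_wrt_map sorted_wrt_append
      using indep_L indep_B by auto
  qed (use lin fixed in auto)
  then show ?thesis
    using typed by (simp add: simply_typed_sequence_def)
qed

text \<open>Input selectability speaks of atoms with variables in all free output positions; here
  every output position holds a variable, so its first condition applies.\<close>

lemma selected_bound_nonvariable:
  assumes sel: "input_selectability P" "selectable P a"
    and a: "wf_atom P a" "psym a \<in> preds P" "\<forall>t\<in>set (outs P a). is_variable t"
    and i: "has_mode Input P (psym a) i" "bound_position P (psym a) i"
  shows "\<not> is_variable (args a ! i)"
proof -
  have "\<forall>i. has_mode Output P (psym a) i \<longrightarrow> is_variable (args a ! i)"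
    using a(1,3) set_select_iff[of "args a" "mode P (psym a)" Output is_variable]
    by (simp add: outs_def has_mode_def wf_atom_def arity_def)
  then show ?thesis
    using sel a i unfolding input_selectability_def by blast
qed

text \<open>The step takes place at index \<open>k\<close> of \<open>Q\<close>, whereas the
  invariant concerns a reordering \<open>L\<close>. The same mgu is applied in \<open>L\<close>,
  with the reordered body put where the selected atom stands there.\<close>

lemma derivation_step_simply_typed:
  fixes P :: "('p, 'f, 'v) program"
  assumes P: "wf_program P" "permutation_simply_typed_program P" "input_linear P"
      "input_selectability P"
    and Q: "mset L = mset Q" "simply_typed_sequence P L"
    and step: "derivation_step P Q k Q'" "selectable P (Q ! k)"
  shows "\<exists>L'. mset L' = mset Q' \<and> simply_typed_sequence P L'"
proof -
  obtain C C' \<theta> where k: "k < length Q" and C: "C \<in> clauses P" "variant C' C"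
    and apart: "vars_clause C' \<inter> vars_query Q = {}"
    and mgu: "is_mgu \<theta> (Q ! k) (head C')"
    and Q': "Q' = subst_query \<theta> (take k Q @ body C' @ drop (Suc k) Q)"
    using step(1) unfolding derivation_step_def by blast
  obtain \<rho> where \<rho>: "bij \<rho>" "C' = subst_clause (\<lambda>x. Var (\<rho> x)) C"
    using C(2) by (auto simp: variant_def)
  let ?\<rho> = "\<lambda>x. Var (\<rho> x) :: ('f, 'v) trm"
  obtain \<pi> where "\<pi> permutes {1..length (body C)}" "simply_typed_clause P \<pi> C"
    using P(2) C(1) by (auto simp: permutation_simply_typed_program_def)
  then obtain B where B: "mset B = mset (body C)" "simply_typed_rule P (head C) B"
    using ex_simply_typed_rule[of P C \<pi>] P(1,3) C(1)
    unfolding wf_program_def input_linear_def by blast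
  define h where "h = head C'"
  define B' where "B' = subst_query ?\<rho> B"
  have h: "h = subst_atom ?\<rho> (head C)"
    by (simp add: h_def \<rho> subst_clause_def)
  have rule: "simply_typed_rule P h B'"
    unfolding h B'_def by (rule simply_typed_rule_rename[OF \<rho>(1) B(2)])
  have B': "mset B' = mset (body C')"
    using B(1) by (simp add: B'_def \<rho> subst_clause_def subst_query_def)
  let ?a = "Q ! k"
  have "?a \<in> set L"
    using k mset_eq_setD[OF Q(1)] by simp
  \<comment> \<open>Any occurrence of the atom in \<open>L\<close> will do, since \<open>L\<close>
    and \<open>Q\<close> are compared as multisets only.\<close>
  then obtain L1 L2 where L: "L = L1 @ ?a # L2"
    by (auto simp: in_set_conv_decomp)
  have Q_split: "Q = take k Q @ ?a # drop (Suc k) Q"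
    using k by (rule id_take_nth_drop)
  have "mset Q = add_mset ?a (mset (take k Q) + mset (drop (Suc k) Q))"
    by (subst Q_split) simp
  moreover have "mset L = add_mset ?a (mset L1 + mset L2)"
    by (subst L) simp
  ultimately have L12: "mset L1 + mset L2 = mset (take k Q) + mset (drop (Suc k) Q)"
    using Q(1) by simp
  have mod: "moded_sequence P (L1 @ ?a # L2)"
    using Q(2) L by (simp add: simply_typed_sequence_def)
  have a: "wf_atom P ?a" "\<forall>t\<in>set (outs P ?a). is_variable t"
    using mod by (auto simp: moded_sequence_def wf_query_def)
  have unif: "subst_atom \<theta> ?a = subst_atom \<theta> h"
    using mgu by (simp add: is_mgu_def h_def)
  then have psym: "psym ?a = psym h"
    by (metis psym_subst_atom)
  then have preds: "psym ?a \<in> preds P"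
    using C(1) by (auto simp: preds_def h)
  have wf_h: "wf_atom P h" and flat: "\<forall>t\<in>set (ins P h). flat t"
    using rule by (auto simp: simply_typed_rule_def)
  \<comment> \<open>These are the premises of \<open>flat_match\<close> at each input position; the
    middle one is where input selectability enters.\<close>
  have "list_all2 (\<lambda>v s. flat v \<and> (is_variable v \<or> \<not> is_variable s) \<and>
          subst_trm \<theta> s = subst_trm \<theta> v) (ins P h) (ins P ?a)"
    unfolding ins_def psym
  proof (subst list_all2_select, goal_cases)
    case 3
    show ?case
    proof (intro allI impI)
      fix i assume i: "i < length (mode P (psym h))" "mode P (psym h) ! i = Input"
      have "subst_trm \<theta> (args ?a ! i) = subst_trm \<theta> (args h ! i)"
        using arg_cong[OF unif, of "\<lambda>a. args a ! i"] i a(1) wf_h psym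
        by (simp add: subst_atom_def wf_atom_def arity_def)
      moreover have "flat (args h ! i)"
        using flat set_select_iff[of "args h" "mode P (psym h)" Input flat] wf_h i
        by (simp add: ins_def wf_atom_def arity_def)
      moreover have "is_variable (args h ! i) \<or> \<not> is_variable (args ?a ! i)"
      proof (rule ccontr)
        assume *: "\<not> ?thesis"
        \<comment> \<open>\<open>bound_position\<close> refers to the program clause itself. A
          renaming turns variables into variables, so a non-variable argument of \<open>h\<close>
          comes from a non-variable argument of \<open>head C\<close>.\<close>
        have "i < length (args (head C))"
          using i wf_h by (simp add: h wf_atom_def arity_def subst_atom_def)
        with * have "\<not> is_variable (args (head C) ! i)"
          by (auto simp: h subst_atom_def is_variable_iff)
        then have "bound_position P (psym ?a) i"
          using i C(1) psym unfolding bound_position_def has_mode_def arity_def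
          by (auto simp: h)
        then have "\<not> is_variable (args ?a ! i)"
          using i psym by (intro selected_bound_nonvariable[OF P(4) step(2) a(1) preds a(2)])
            (simp_all add: has_mode_def arity_def)
        with * show False
          by simp
      qed
      ultimately show "flat (args h ! i) \<and> (is_variable (args h ! i) \<or> \<not> is_variable (args ?a ! i)) \<and>
          subst_trm \<theta> (args ?a ! i) = subst_trm \<theta> (args h ! i)"
        by blast
    qed
  qed (use a wf_h psym in \<open>simp_all add: wf_atom_def arity_def\<close>)
  then have match: "list_all2 (\<lambda>v s. \<exists>\<sigma>. subst_trm \<sigma> v = s) (ins P h) (ins P ?a)"
    by (rule list_all2_mono) (blast intro: flat_match)
  have "simply_typed_sequence P (subst_query \<theta> (L1 @ B' @ L2))"
  proof (rule simply_typed_resolvent[OF _ rule match])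
    show "simply_typed_sequence P (L1 @ ?a # L2)"
      using Q(2) L by simp
    have "set (L1 @ ?a # L2) = set Q"
      using mset_eq_setD[OF Q(1)] L by simp
    moreover have "set (h # B') = set (h # body C')"
      using mset_eq_setD[OF B'] by simp
    ultimately show "vars_query (h # B') \<inter> vars_query (L1 @ ?a # L2) = {}"
      using apart unfolding vars_clause_def vars_query_def h_def by simp
    show "is_mgu \<theta> ?a h"
      using mgu by (simp add: h_def)
  qed
  moreover have "mset (subst_query \<theta> (L1 @ B' @ L2)) = mset Q'"
  proof -
    have "mset (L1 @ B' @ L2) = mset (take k Q @ body C' @ drop (Suc k) Q)"
      using L12 B' by (simp add: ac_simps)
    then show ?thesis
      unfolding Q' subst_query_def mset_map by (rule arg_cong)
  qed
  ultimately show ?thesis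
    by blast
qed

text \<open>The output arguments are distinct variables and the types are non-empty, so the output
  arguments can be instantiated to be correctly typed.\<close>

lemma ins_type_consistent:
  assumes "wf_program P" "simply_typed_sequence P L" "a \<in> set L"
  shows "list_all2 (\<lambda>t T. \<exists>\<sigma>. subst_trm \<sigma> t \<in> T) (ins P a) (in_types P a)"
proof -
  have mod: "moded_sequence P L"
    using assms(2) by (simp add: simply_typed_sequence_def)
  have len: "length (args b) = length (mode P (psym b))"
      "length (types P (psym b)) = length (mode P (psym b))" if "b \<in> set L" for b
    using assms(1) mod that
    by (auto simp: wf_program_def moded_sequence_def wf_query_def wf_atom_def arity_def)
  \<comment> \<open>One chosen element of each output type, in the order of
    \<open>out_terms P L\<close>.\<close>
  let ?ss = "concat (map (\<lambda>b. map (\<lambda>T. SOME t. t \<in> T) (out_types P b)) L)"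
  have out_len: "length (outs P b) = length (out_types P b)" if "b \<in> set L" for b
  proof -
    have "list_all2 (\<lambda>_ _. True) (outs P b) (out_types P b)"
      using len[OF that] by (simp add: outs_def out_types_def list_all2_select)
    then show ?thesis
      by (rule list_all2_lengthD)
  qed
  have "length (out_terms P M) =
      length (concat (map (\<lambda>b. map (\<lambda>T. SOME t. t \<in> T) (out_types P b)) M))"
    if "set M \<subseteq> set L" for M
    using that out_len by (induction M) auto
  then have "length (out_terms P L) = length ?ss"
    by blast
  moreover have "linear (out_terms P L)" "\<forall>t\<in>set (out_terms P L). is_variable t"
    using mod unfolding moded_sequence_def by blast+
  ultimately obtain \<sigma> where \<sigma>: "map (subst_trm \<sigma>) (out_terms P L) = ?ss"
    using variables_match by blast
  \<comment> \<open>Cuts the equation for the whole list into one equation per atom. It is stated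
    for any list \<open>M\<close> of atoms from \<open>L\<close>, so that the induction retains the
    matching lengths of the blocks.\<close>
  have eq: "\<forall>b\<in>set M. map (subst_trm \<sigma>) (outs P b) = map (\<lambda>T. SOME t. t \<in> T) (out_types P b)"
    if "set M \<subseteq> set L" "map (subst_trm \<sigma>) (out_terms P M) =
        concat (map (\<lambda>b. map (\<lambda>T. SOME t. t \<in> T) (out_types P b)) M)" for M
    using that
  proof (induction M)
    case (Cons b M)
    then show ?case
      using out_len[of b] by (auto simp: append_eq_append_conv)
  qed simp
  have outs: "outs_typed P \<sigma> b" if "b \<in> set L" for b
  proof -
    have "(SOME t. t \<in> T) \<in> T" if "T \<in> set (out_types P b)" for T
    proof -
      have "T \<in> set (types P (psym b))"
        using that set_select_subset[of Output "mode P (psym b)" "types P (psym b)"]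
        by (auto simp: out_types_def)
      then have "is_type T"
        using assms(1) by (auto simp: wf_program_def)
      then show ?thesis
        by (simp add: is_type_def some_in_eq)
    qed
    moreover have "map (subst_trm \<sigma>) (outs P b) = map (\<lambda>T. SOME t. t \<in> T) (out_types P b)"
      using eq[OF subset_refl \<sigma>] that by blast
    ultimately show ?thesis
      by (simp add: outs_typed_def has_types_def list_all2_conv_all_nth)
  qed
  obtain L1 L2 where "L = L1 @ a # L2"
    using assms(3) by (auto simp: in_set_conv_decomp)
  moreover have "typed_sequence P \<sigma> L"
    using assms(2) by (simp add: simply_typed_sequence_def)
  \<comment> \<open>With all outputs typed under \<open>\<sigma>\<close>, every premise that guards
    the inputs of \<open>a\<close> is satisfied.\<close>
  ultimately have "ins_typed P \<sigma> a"
    using outs by (simp add: typed_sequence_append)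
  then show ?thesis
    by (auto simp: ins_typed_def has_types_def list_all2_conv_all_nth)
qed

text \<open>A non-variable term with a constant as an instance has no arguments, so it equals that
  instance.\<close>

lemma constant_type_instanceD:
  assumes "constant_type T" "\<not> is_variable t" "subst_trm \<sigma> t \<in> T"
  shows "t \<in> T"
  using assms by (cases t) (auto simp: constant_type_def)

theorem theorem6p2:
  fixes P :: "('p, 'f, 'v) program"
    and Q :: "('p, 'f, 'v) query"
    and p :: "'p pred_sym"
    and N :: enat
    and qs :: "nat \<Rightarrow> ('p, 'f, 'v) query"
    and sel :: "nat \<Rightarrow> nat option"
  assumes "wf_program P"
    and "permutation_simply_typed_program P"
    and "input_linear P"
    and "input_selectability P"
    and "wf_query P Q"
    and "permutation_simply_typed_query P Q"
    and "\<And>i. has_mode Input P p i \<Longrightarrow> bound_position P p i \<and> constant_type (types P p ! i)"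
    and "derivation P Q N qs sel"
    and "delay_respecting P N qs sel"
  shows "\<forall>i k. enat i \<le> N \<and> sel i = Some k \<and> psym (qs i ! k) = p \<longrightarrow>
           has_types (ins P (qs i ! k)) (in_types P (qs i ! k))"
proof (intro allI impI, elim conjE)
  fix i k
  assume i: "enat i \<le> N" and k: "sel i = Some k" and p: "psym (qs i ! k) = p"
  \<comment> \<open>The range includes \<open>i = N\<close>: an atom selected in the last query is
    covered although no step resolves it.\<close>
  have "\<exists>L. mset L = mset (qs i) \<and> simply_typed_sequence P L"
    using i
  proof (induction i)
    case 0
    then show ?case
      using ex_simply_typed_sequence[OF assms(5,6)] assms(8) by (simp add: derivation_def)
  next
    case (Suc i)
    \<comment> \<open>That query \<open>Suc i\<close> belongs to the derivation means that step
      \<open>i\<close> is performed.\<close>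
    then have i: "enat i < N"
      by (simp add: Suc_ile_eq)
    then obtain L where "mset L = mset (qs i)" "simply_typed_sequence P L"
      using Suc.IH less_imp_le by blast
    moreover obtain k where "sel i = Some k" "derivation_step P (qs i) k (qs (Suc i))"
      using assms(8) i by (auto simp: derivation_def)
    moreover have "selectable P (qs i ! k)" if "sel i = Some k" for k
      using assms(9) i that by (simp add: delay_respecting_def)
    ultimately show ?case
      using derivation_step_simply_typed[OF assms(1-4)] by blast
  qed
  then obtain L where L: "mset L = mset (qs i)" "simply_typed_sequence P L"
    by blast
  let ?a = "qs i ! k"
  have "k < length (qs i)"
    using assms(8) i k by (simp add: derivation_def)
  then have "?a \<in> set L"
    using mset_eq_setD[OF L(1)] by simp
  note cons = ins_type_consistent[OF assms(1) L(2) this]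
  have a: "wf_atom P ?a" "\<forall>t\<in>set (outs P ?a). is_variable t"
    using L(2) \<open>?a \<in> set L\<close>
    by (auto simp: simply_typed_sequence_def moded_sequence_def wf_query_def)
  have sel: "selectable P ?a"
    using assms(9) i k by (simp add: delay_respecting_def)
  have len: "length (args ?a) = length (mode P p)" "length (types P p) = length (mode P p)"
    using a(1) assms(1) p by (auto simp: wf_atom_def wf_program_def arity_def)
  have "args ?a ! j \<in> types P p ! j" if j: "j < length (mode P p)" "mode P p ! j = Input" for j
  proof -
    have mode: "has_mode Input P p j"
      using j by (simp add: has_mode_def arity_def)
    note bound = assms(7)[OF this]
    \<comment> \<open>A bound input position comes from a clause head that uses \<open>p\<close>.
      This is available once an input position \<open>j\<close> is given; without one there is
      nothing to show.\<close>
    have "p \<in> preds P"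
      using mode bound by (auto simp: bound_position_def has_mode_def preds_def)
    then have "\<not> is_variable (args ?a ! j)"
      using selected_bound_nonvariable[OF assms(4) sel a(1) _ a(2)] p mode bound by simp
    moreover have "\<exists>\<sigma>. subst_trm \<sigma> (args ?a ! j) \<in> types P p ! j"
      using cons j len unfolding ins_def in_types_def p by (simp add: list_all2_select)
    ultimately show ?thesis
      using bound constant_type_instanceD by blast
  qed
  then show "has_types (ins P ?a) (in_types P ?a)"
    unfolding has_types_def ins_def in_types_def p using len by (simp add: list_all2_select)
qed

end
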